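(* Let $\mathbf K$ be as in the context and let $\downarrow$ be a simple independence relation in $\mathbf K$ with the $(<\aleph_0)$-witness property for singletons. Then the following are equivalent: (1) $\downarrow$ is a supersimple independence relation; (2) for every $M\in\mathbf K$ and every $p\in\mathbf S(M)$, $U(p)<\infty$.
   Context: $\mathbf{K}$ is an abstract elementary class (AEC) with strong substructure relation $\le_{\mathbf K}$ and Löwenheim–Skolem–Tarski number $\operatorname{LS}(\mathbf K)$, with joint embedding, amalgamation and no maximal models; we work in a monster model $\mathfrak C$. Galois-types $\mathbf{tp}(\mathbf b/A)$ are orbits of $\mathbf b$ under automorphisms of $\mathfrak C$ fixing $A$ pointwise; $\mathbf S^\alpha(M)$, $\mathbf S^\alpha(A)$ are the sets of Galois-types of length $\alpha$ over $M$, $A$; $\mathbf S(M)=\mathbf S^1(M)$, $\mathbf S^{<\infty}=\bigcup_\alpha\mathbf S^\alpha$. An independence relation is a relation $A\downarrow_M B$ ($M\le_{\mathbf K}\mathfrak C$, $A,B\subseteq\mathfrak C$) satisfying: invariance under automorphisms of $\mathfrak C$; monotonicity; normality ($A\downarrow_MB$ iff $A\cup M\downarrow_MB\cup M$); base monotonicity (if $A\downarrow_MB$, $M\le_{\mathbf K}N$, $|N|\subseteq B$ then $A\downarrow_NB$); existence (every $p\in\mathbf S^{<\infty}(M)$ has, for each $N\ge_{\mathbf K}M$, an extension in $\mathbf S^{<\infty}(N)$ not forking over $M$); transitivity (if $M\le_{\mathbf K}N$, $A\downarrow_MN$, $A\downarrow_NB$ then $A\downarrow_MB$). "$\mathbf{tp}(\bar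 a/B)$ does not fork over $M$" means $\mathrm{ran}(\bar a)\downarrow_MB$; for $p\in\mathbf S(M)$, $q\in\mathbf S(N)$, $M\le_{\mathbf K}N$, $q$ is a forking extension of $p$ if $q$ extends $p$ and forks over $M$. A simple independence relation additionally satisfies symmetry ($A\downarrow_MB$ iff $B\downarrow_MA$); type-amalgamation (if $p\in\mathbf S^{<\infty}(M)$, $M\subseteq A,B$, $A\downarrow_MB$, $N^*\in\mathbf K$ contains $A\cup B$, and $q_1\in\mathbf S^{<\infty}(A)$, $q_2\in\mathbf S^{<\infty}(B)$ both extend $p$ and do not fork over $M$, then some $q\in\mathbf S^{<\infty}(N^* )$ extends $q_1,q_2$ and does not fork over $M$); uniform local character (there are cardinals $\lambda,\theta$ such that every $p\in\mathbf S^\alpha(M)$ does not fork over some $M_0\le_{\mathbf K}M$ with $\|M_0\|\le\lambda+\alpha^{<\theta}$). It is supersimple if moreover it has finite local character: for every limit ordinal $\delta$, every $\le_{\mathbf K}$-increasing continuous chain $\{M_i:i\le\delta\}$ and every $p\in\mathbf S(M_\delta)$, there is $i<\delta$ with $p$ not forking over $M_i$. The $(<\aleph_0)$-witness property for singletons: for all $M\le_{\mathbf K}N$ and $b\in\mathfrak C$, $b\downarrow_MN$ iff $b\downarrow_MA$ for every finite $A\subseteq N$. $U$-rank: for $p\in\mathbf S(M)$, $U(p)\ge0$; for limit $\alpha$, $U(p)\ge\alpha$ iff $U(p)\ge\beta$ for all $\beta<\alpha$; $U(p)\ge\beta+1$ iff there are $M'\ge_{\mathbf K}M$ with $\|M'\|=\|M\|$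 and $p'\in\mathbf S(M')$ a forking extension of $p$ with $U(p')\ge\beta$; $U(p)=\alpha$ iff $U(p)\ge\alpha$ and not $U(p)\ge\alpha+1$; $U(p)=\infty$ iff $U(p)\ge\alpha$ for every ordinal $\alpha$. *)

theory Defs
  imports Main
begin

unbundle cardinal_syntax

text \<open>
  Conventions.

  The elements of all structures live in one type \<open>'a\<close>, so a class of models is a set of structures
  with universe contained in \<open>'a\<close>. Ordinals are the elements of a well-ordered type \<open>'o\<close>: \<open>\<alpha> :: 'o\<close>
  stands for the order type of \<open>{..<\<alpha>}\<close>. Statements that quantify over all ordinals carry the
  argument \<open>TYPE('o)\<close>; they mean what they should as soon as \<open>'o\<close> has more than \<open>2\<^bsup>|'a|\<^esup>\<close> elements,
  which bounds the number of pairs (model, type), hence the ordinals that are values of the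
  rank and the lengths of strictly increasing chains.

  As usual with a monster model \<open>\<CC>\<close>, ``small'' means of cardinality less than that of \<open>\<CC>\<close>; models are
  small strong submodels of \<open>\<CC>\<close>, and parameter sets and tuples are small.
\<close>

section \<open>Structures\<close>

record ('f, 'r) language =
  funs :: "'f set"
  rels :: "'r set"
  farity :: "'f \<Rightarrow> nat"
  rarity :: "'r \<Rightarrow> nat"

record ('f, 'r, 'a) struc =
  uni :: "'a set"
  fint :: "'f \<Rightarrow> 'a list \<Rightarrow> 'a"
  rint :: "'r \<Rightarrow> 'a list \<Rightarrow> bool"

text \<open>Interpretations have fixed values outside their domain, so that equality of records is
  equality of structures.\<close>

definition is_struc :: "('f, 'r) language \<Rightarrow> ('f, 'r, 'a) struc \<Rightarrow> bool" where
  "is_struc L M \<longleftrightarrow>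
     uni M \<noteq> {} \<and>
     (\<forall>f xs. if f \<in> funs L \<and> set xs \<subseteq> uni M \<and> length xs = farity L f
             then fint M f xs \<in> uni M else fint M f xs = undefined) \<and>
     (\<forall>r xs. rint M r xs \<longrightarrow> r \<in> rels L \<and> set xs \<subseteq> uni M \<and> length xs = rarity L r)"

definition substruc ::
  "('f, 'r) language \<Rightarrow> ('f, 'r, 'a) struc \<Rightarrow> ('f, 'r, 'a) struc \<Rightarrow> bool" where
  "substruc L M N \<longleftrightarrow>
     is_struc L M \<and> is_struc L N \<and> uni M \<subseteq> uni N \<and>
     (\<forall>f\<in>funs L. \<forall>xs. set xs \<subseteq> uni M \<and> length xs = farity L f \<longrightarrow> fint M f xs = fint N f xs) \<and>
     (\<forall>r\<in>rels L. \<forall>xs. set xs \<subseteq> uni M \<and> length xs = rarity L r \<longrightarrow> (rint M r xs \<longleftrightarrow> rint N r xs))"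

definition struc_iso ::
  "('f, 'r) language \<Rightarrow> ('a \<Rightarrow> 'a) \<Rightarrow> ('f, 'r, 'a) struc \<Rightarrow> ('f, 'r, 'a) struc \<Rightarrow> bool" where
  "struc_iso L h M N \<longleftrightarrow>
     is_struc L M \<and> is_struc L N \<and> bij_betw h (uni M) (uni N) \<and>
     (\<forall>f\<in>funs L. \<forall>xs. set xs \<subseteq> uni M \<and> length xs = farity L f \<longrightarrow>
        h (fint M f xs) = fint N f (map h xs)) \<and>
     (\<forall>r\<in>rels L. \<forall>xs. set xs \<subseteq> uni M \<and> length xs = rarity L r \<longrightarrow>
        (rint M r xs \<longleftrightarrow> rint N r (map h xs)))"

section \<open>Abstract elementary classes\<close>

record ('f, 'r, 'a) aclass =
  lang :: "('f, 'r) language"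
  mods :: "('f, 'r, 'a) struc set"
  leK :: "('f, 'r, 'a) struc \<Rightarrow> ('f, 'r, 'a) struc \<Rightarrow> bool"

definition LS_bound :: "('f, 'r, 'a) aclass \<Rightarrow> 'a rel \<Rightarrow> bool" where
  "LS_bound K \<mu> \<longleftrightarrow>
     Card_order \<mu> \<and> |UNIV :: nat set| \<le>o \<mu> \<and> |funs (lang K)| +c |rels (lang K)| \<le>o \<mu> \<and>
     (\<forall>M\<in>mods K. \<forall>A\<subseteq>uni M. \<exists>N. leK K N M \<and> A \<subseteq> uni N \<and> |uni N| \<le>o |A| +c \<mu>)"

definition LS :: "('f, 'r, 'a) aclass \<Rightarrow> 'a rel" where
  "LS K = (SOME \<mu>. LS_bound K \<mu> \<and> (\<forall>\<nu>. LS_bound K \<nu> \<longrightarrow> \<mu> \<le>o \<nu>))"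

text \<open>In the chain axiom, the range of an increasing chain indexed by an ordinal is given as a set
  of models well-ordered by the strong substructure relation. The structure on the union is
  determined by its universe, since all members of the chain are substructures of it.\<close>

definition is_aec :: "('f, 'r, 'a) aclass \<Rightarrow> bool" where
  "is_aec K \<longleftrightarrow>
     (\<forall>M\<in>mods K. is_struc (lang K) M) \<and>
     partial_order_on (mods K) {(M, N). leK K M N} \<and>
     (\<forall>M N. leK K M N \<longrightarrow> substruc (lang K) M N) \<and>
     (\<forall>M N h. M \<in> mods K \<and> struc_iso (lang K) h M N \<longrightarrow> N \<in> mods K) \<and>
     (\<forall>M N M' N' h. leK K M N \<and> struc_iso (lang K) h N N' \<and> struc_iso (lang K) h M M' \<longrightarrow> leK K M' N') \<and>
     (\<forall>M0 M1 M2. leK K M0 M2 \<and> leK K M1 M2 \<and> uni M0 \<subseteq> uni M1 \<longrightarrow> leK K M0 M1) \<and>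
     (\<forall>\<C>. \<C> \<subseteq> mods K \<and> \<C> \<noteq> {} \<and> well_order_on \<C> {(M, N). M \<in> \<C> \<and> N \<in> \<C> \<and> leK K M N} \<longrightarrow>
        (\<exists>U\<in>mods K. uni U = (\<Union>M\<in>\<C>. uni M) \<and> (\<forall>M\<in>\<C>. leK K M U) \<and>
           (\<forall>N\<in>mods K. (\<forall>M\<in>\<C>. leK K M N) \<longrightarrow> leK K U N))) \<and>
     (\<exists>\<mu>. LS_bound K \<mu>)"

definition K_embedding ::
  "('f, 'r, 'a) aclass \<Rightarrow> ('a \<Rightarrow> 'a) \<Rightarrow> ('f, 'r, 'a) struc \<Rightarrow> ('f, 'r, 'a) struc \<Rightarrow> bool" where
  "K_embedding K h M N \<longleftrightarrow> (\<exists>M'. struc_iso (lang K) h M M' \<and> leK K M' N)"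

definition joint_embedding :: "('f, 'r, 'a) aclass \<Rightarrow> bool" where
  "joint_embedding K \<longleftrightarrow>
     (\<forall>M\<in>mods K. \<forall>N\<in>mods K. \<exists>P\<in>mods K. \<exists>f g. K_embedding K f M P \<and> K_embedding K g N P)"

definition amalgamation :: "('f, 'r, 'a) aclass \<Rightarrow> bool" where
  "amalgamation K \<longleftrightarrow>
     (\<forall>M0 M1 M2. leK K M0 M1 \<and> leK K M0 M2 \<longrightarrow>
        (\<exists>P\<in>mods K. \<exists>f g. K_embedding K f M1 P \<and> K_embedding K g M2 P \<and>
           (\<forall>a\<in>uni M0. f a = g a)))"

text \<open>A model whose universe is all of \<open>'a\<close> has no proper extension inside \<open>'a\<close>, but it may have a
  proper embedding; up to isomorphism this is the same.\<close>

definition no_maximal_models :: "('f, 'r, 'a) aclass \<Rightarrow> bool" where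
  "no_maximal_models K \<longleftrightarrow>
     (\<forall>M\<in>mods K. \<exists>N\<in>mods K. \<exists>f. K_embedding K f M N \<and> f ` uni M \<noteq> uni N)"

section \<open>The monster model and Galois types\<close>

definition automorphism :: "('f, 'r, 'a) aclass \<Rightarrow> ('f, 'r, 'a) struc \<Rightarrow> ('a \<Rightarrow> 'a) \<Rightarrow> bool" where
  "automorphism K C h \<longleftrightarrow> struc_iso (lang K) h C C"

definition small :: "('f, 'r, 'a) struc \<Rightarrow> 'b set \<Rightarrow> bool" where
  "small C A \<longleftrightarrow> |A| <o |uni C|"

definition small_model ::
  "('f, 'r, 'a) aclass \<Rightarrow> ('f, 'r, 'a) struc \<Rightarrow> ('f, 'r, 'a) struc \<Rightarrow> bool" where
  "small_model K C M \<longleftrightarrow> leK K M C \<and> small C (uni M)"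

definition small_subset :: "('f, 'r, 'a) struc \<Rightarrow> 'a set \<Rightarrow> bool" where
  "small_subset C A \<longleftrightarrow> A \<subseteq> uni C \<and> small C A"

text \<open>Larger than the Loewenheim-Skolem-Tarski number, universal for small models, and strongly
  homogeneous for small models.\<close>

definition monster_model :: "('f, 'r, 'a) aclass \<Rightarrow> ('f, 'r, 'a) struc \<Rightarrow> bool" where
  "monster_model K C \<longleftrightarrow>
     C \<in> mods K \<and> LS K <o |uni C| \<and>
     (\<forall>M\<in>mods K. small C (uni M) \<longrightarrow> (\<exists>h. K_embedding K h M C)) \<and>
     (\<forall>M N h. small_model K C M \<and> small_model K C N \<and> struc_iso (lang K) h M N \<longrightarrow>
        (\<exists>g. automorphism K C g \<and> (\<forall>a\<in>uni M. g a = h a)))"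

text \<open>A tuple of length \<open>\<alpha>\<close> is a partial map with domain \<open>{..<\<alpha>}\<close>. A type is an orbit and does not
  determine its domain, which is therefore always passed separately.\<close>

definition gtp ::
  "('f, 'r, 'a) aclass \<Rightarrow> ('f, 'r, 'a) struc \<Rightarrow> ('o \<Rightarrow> 'a option) \<Rightarrow> 'a set \<Rightarrow> ('o \<Rightarrow> 'a option) set"
  where
  "gtp K C b A = {map_option h \<circ> b | h. automorphism K C h \<and> (\<forall>a\<in>A. h a = a)}"

definition gS ::
  "('f, 'r, 'a) aclass \<Rightarrow> ('f, 'r, 'a) struc \<Rightarrow> 'o::wellorder \<Rightarrow> 'a set \<Rightarrow> ('o \<Rightarrow> 'a option) set set"
  where
  "gS K C \<alpha> A = {gtp K C b A | b. dom b = {..<\<alpha>} \<and> ran b \<subseteq> uni C}"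

definition gS_all ::
  "('f, 'r, 'a) aclass \<Rightarrow> ('f, 'r, 'a) struc \<Rightarrow> 'a set \<Rightarrow> ('o::wellorder \<Rightarrow> 'a option) set set" where
  "gS_all K C A = (\<Union>\<alpha>\<in>{\<alpha>. small C {..<\<alpha>}}. gS K C \<alpha> A)"

definition ord_one :: "'o::wellorder" where
  "ord_one = (LEAST \<alpha>. \<exists>\<beta>. \<beta> < \<alpha>)"

abbreviation gS1 ::
  "('f, 'r, 'a) aclass \<Rightarrow> ('f, 'r, 'a) struc \<Rightarrow> 'a set \<Rightarrow> ('o::wellorder \<Rightarrow> 'a option) set set" where
  "gS1 K C A \<equiv> gS K C ord_one A"

definition grestrict ::
  "('f, 'r, 'a) aclass \<Rightarrow> ('f, 'r, 'a) struc \<Rightarrow> ('o \<Rightarrow> 'a option) set \<Rightarrow> 'a set \<Rightarrow>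
     ('o \<Rightarrow> 'a option) set" where
  "grestrict K C q A = (\<Union>b\<in>q. gtp K C b A)"

section \<open>Independence relations\<close>

type_synonym ('f, 'r, 'a) indep = "'a set \<Rightarrow> ('f, 'r, 'a) struc \<Rightarrow> 'a set \<Rightarrow> bool"

text \<open>The type \<open>p\<close> over \<open>B\<close> does not fork over \<open>M\<close>.\<close>

definition nonforking ::
  "('f, 'r, 'a) aclass \<Rightarrow> ('f, 'r, 'a) struc \<Rightarrow> ('f, 'r, 'a) indep \<Rightarrow>
     ('o \<Rightarrow> 'a option) set \<Rightarrow> 'a set \<Rightarrow> ('f, 'r, 'a) struc \<Rightarrow> bool" where
  "nonforking K C ind p B M \<longleftrightarrow> (\<exists>b. p = gtp K C b B \<and> ind (ran b) M B)"

definition ind_invariance ::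
  "('f, 'r, 'a) aclass \<Rightarrow> ('f, 'r, 'a) struc \<Rightarrow> ('f, 'r, 'a) indep \<Rightarrow> bool" where
  "ind_invariance K C ind \<longleftrightarrow>
     (\<forall>h A M B M'. automorphism K C h \<and> small_model K C M \<and> small_subset C A \<and> small_subset C B \<and>
        struc_iso (lang K) h M M' \<and> ind A M B \<longrightarrow> ind (h ` A) M' (h ` B))"

definition ind_monotonicity ::
  "('f, 'r, 'a) aclass \<Rightarrow> ('f, 'r, 'a) struc \<Rightarrow> ('f, 'r, 'a) indep \<Rightarrow> bool" where
  "ind_monotonicity K C ind \<longleftrightarrow>
     (\<forall>A M B A0 B0. small_model K C M \<and> small_subset C A \<and> small_subset C B \<and>
        A0 \<subseteq> A \<and> B0 \<subseteq> B \<and> ind A M B \<longrightarrow> ind A0 M B0)"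

definition ind_normality ::
  "('f, 'r, 'a) aclass \<Rightarrow> ('f, 'r, 'a) struc \<Rightarrow> ('f, 'r, 'a) indep \<Rightarrow> bool" where
  "ind_normality K C ind \<longleftrightarrow>
     (\<forall>A M B. small_model K C M \<and> small_subset C A \<and> small_subset C B \<longrightarrow>
        (ind A M B \<longleftrightarrow> ind (A \<union> uni M) M (B \<union> uni M)))"

definition ind_base_monotonicity ::
  "('f, 'r, 'a) aclass \<Rightarrow> ('f, 'r, 'a) struc \<Rightarrow> ('f, 'r, 'a) indep \<Rightarrow> bool" where
  "ind_base_monotonicity K C ind \<longleftrightarrow>
     (\<forall>A M N B. small_model K C M \<and> small_model K C N \<and> small_subset C A \<and> small_subset C B \<and>
        ind A M B \<and> leK K M N \<and> uni N \<subseteq> B \<longrightarrow> ind A N B)"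

definition ind_existence ::
  "'o::wellorder itself \<Rightarrow> ('f, 'r, 'a) aclass \<Rightarrow> ('f, 'r, 'a) struc \<Rightarrow> ('f, 'r, 'a) indep \<Rightarrow> bool"
  where
  "ind_existence ord K C ind \<longleftrightarrow>
     (\<forall>M N. \<forall>p :: ('o \<Rightarrow> 'a option) set.
        small_model K C M \<and> small_model K C N \<and> leK K M N \<and> p \<in> gS_all K C (uni M) \<longrightarrow>
        (\<exists>q\<in>gS_all K C (uni N). grestrict K C q (uni M) = p \<and> nonforking K C ind q (uni N) M))"

definition ind_transitivity ::
  "('f, 'r, 'a) aclass \<Rightarrow> ('f, 'r, 'a) struc \<Rightarrow> ('f, 'r, 'a) indep \<Rightarrow> bool" where
  "ind_transitivity K C ind \<longleftrightarrow>
     (\<forall>A M N B. small_model K C M \<and> small_model K C N \<and> small_subset C A \<and> small_subset C B \<and>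
        leK K M N \<and> ind A M (uni N) \<and> ind A N B \<longrightarrow> ind A M B)"

definition independence_relation ::
  "'o::wellorder itself \<Rightarrow> ('f, 'r, 'a) aclass \<Rightarrow> ('f, 'r, 'a) struc \<Rightarrow> ('f, 'r, 'a) indep \<Rightarrow> bool"
  where
  "independence_relation ord K C ind \<longleftrightarrow>
     ind_invariance K C ind \<and> ind_monotonicity K C ind \<and> ind_normality K C ind \<and>
     ind_base_monotonicity K C ind \<and> ind_existence ord K C ind \<and> ind_transitivity K C ind"

definition ind_symmetry ::
  "('f, 'r, 'a) aclass \<Rightarrow> ('f, 'r, 'a) struc \<Rightarrow> ('f, 'r, 'a) indep \<Rightarrow> bool" where
  "ind_symmetry K C ind \<longleftrightarrow>
     (\<forall>A M B. small_model K C M \<and> small_subset C A \<and> small_subset C B \<longrightarrow>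
        (ind A M B \<longleftrightarrow> ind B M A))"

definition ind_type_amalgamation ::
  "'o::wellorder itself \<Rightarrow> ('f, 'r, 'a) aclass \<Rightarrow> ('f, 'r, 'a) struc \<Rightarrow> ('f, 'r, 'a) indep \<Rightarrow> bool"
  where
  "ind_type_amalgamation ord K C ind \<longleftrightarrow>
     (\<forall>M A B N. \<forall>p q1 q2 :: ('o \<Rightarrow> 'a option) set.
        small_model K C M \<and> small_subset C A \<and> small_subset C B \<and> small_model K C N \<and>
        p \<in> gS_all K C (uni M) \<and> uni M \<subseteq> A \<and> uni M \<subseteq> B \<and> ind A M B \<and> A \<union> B \<subseteq> uni N \<and>
        q1 \<in> gS_all K C A \<and> grestrict K C q1 (uni M) = p \<and> nonforking K C ind q1 A M \<and>
        q2 \<in> gS_all K C B \<and> grestrict K C q2 (uni M) = p \<and> nonforking K C ind q2 B M \<longrightarrow>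
        (\<exists>q\<in>gS_all K C (uni N). grestrict K C q A = q1 \<and> grestrict K C q B = q2 \<and>
           nonforking K C ind q (uni N) M))"

text \<open>The cardinal \<open>\<kappa>\<^bsup><\<theta>\<^esup>\<close>, the supremum of the \<open>\<kappa>\<^bsup>\<mu>\<^esup>\<close> for cardinals \<open>\<mu> < \<theta>\<close>.\<close>

definition cexp_below :: "'b rel \<Rightarrow> 'c rel \<Rightarrow> ('c \<Rightarrow> 'b) rel" where
  "cexp_below \<kappa> \<theta> = (SOME \<sigma>.
     Card_order \<sigma> \<and> (\<forall>\<mu> :: 'c rel. Card_order \<mu> \<and> \<mu> <o \<theta> \<longrightarrow> \<kappa> ^c \<mu> \<le>o \<sigma>) \<and>
     (\<forall>\<tau> :: ('c \<Rightarrow> 'b) rel. Card_order \<tau> \<and>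
        (\<forall>\<mu> :: 'c rel. Card_order \<mu> \<and> \<mu> <o \<theta> \<longrightarrow> \<kappa> ^c \<mu> \<le>o \<tau>) \<longrightarrow> \<sigma> \<le>o \<tau>))"

text \<open>The monster model is larger than the two cardinals; otherwise the condition would be void.\<close>

definition ind_uniform_local_character ::
  "'o::wellorder itself \<Rightarrow> ('f, 'r, 'a) aclass \<Rightarrow> ('f, 'r, 'a) struc \<Rightarrow> ('f, 'r, 'a) indep \<Rightarrow> bool"
  where
  "ind_uniform_local_character ord K C ind \<longleftrightarrow>
     (\<exists>(\<chi> :: 'a rel) (\<theta> :: 'a rel).
        Card_order \<chi> \<and> Card_order \<theta> \<and> \<chi> <o |uni C| \<and> \<theta> <o |uni C| \<and>
        (\<forall>\<alpha> :: 'o. \<forall>M. \<forall>p\<in>gS K C \<alpha> (uni M). small C {..<\<alpha>} \<and> small_model K C M \<longrightarrow>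
           (\<exists>M0. small_model K C M0 \<and> leK K M0 M \<and> nonforking K C ind p (uni M) M0 \<and>
              |uni M0| \<le>o \<chi> +c cexp_below |{..<\<alpha>}| \<theta>)))"

definition simple_independence_relation ::
  "'o::wellorder itself \<Rightarrow> ('f, 'r, 'a) aclass \<Rightarrow> ('f, 'r, 'a) struc \<Rightarrow> ('f, 'r, 'a) indep \<Rightarrow> bool"
  where
  "simple_independence_relation ord K C ind \<longleftrightarrow>
     independence_relation ord K C ind \<and> ind_symmetry K C ind \<and>
     ind_type_amalgamation ord K C ind \<and> ind_uniform_local_character ord K C ind"

definition is_succ :: "'o::wellorder \<Rightarrow> 'o \<Rightarrow> bool" where
  "is_succ \<beta> \<alpha> \<longleftrightarrow> \<beta> < \<alpha> \<and> (\<forall>\<gamma>. \<beta> < \<gamma> \<longrightarrow> \<alpha> \<le> \<gamma>)"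

definition is_zero :: "'o::wellorder \<Rightarrow> bool" where
  "is_zero \<alpha> \<longleftrightarrow> (\<forall>\<beta>. \<alpha> \<le> \<beta>)"

definition is_limit :: "'o::wellorder \<Rightarrow> bool" where
  "is_limit \<alpha> \<longleftrightarrow> \<not> is_zero \<alpha> \<and> (\<nexists>\<beta>. is_succ \<beta> \<alpha>)"

definition continuous_chain ::
  "('f, 'r, 'a) aclass \<Rightarrow> ('f, 'r, 'a) struc \<Rightarrow> 'o::wellorder \<Rightarrow> ('o \<Rightarrow> ('f, 'r, 'a) struc) \<Rightarrow> bool"
  where
  "continuous_chain K C \<delta> M \<longleftrightarrow>
     (\<forall>i\<le>\<delta>. small_model K C (M i)) \<and>
     (\<forall>i j. i \<le> j \<and> j \<le> \<delta> \<longrightarrow> leK K (M i) (M j)) \<and>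
     (\<forall>j\<le>\<delta>. is_limit j \<longrightarrow> uni (M j) = (\<Union>i\<in>{..<j}. uni (M i)))"

definition ind_finite_local_character ::
  "'o::wellorder itself \<Rightarrow> ('f, 'r, 'a) aclass \<Rightarrow> ('f, 'r, 'a) struc \<Rightarrow> ('f, 'r, 'a) indep \<Rightarrow> bool"
  where
  "ind_finite_local_character ord K C ind \<longleftrightarrow>
     (\<forall>\<delta> :: 'o. \<forall>M. \<forall>p :: ('o \<Rightarrow> 'a option) set.
        is_limit \<delta> \<and> continuous_chain K C \<delta> M \<and> p \<in> gS1 K C (uni (M \<delta>)) \<longrightarrow>
        (\<exists>i<\<delta>. nonforking K C ind p (uni (M \<delta>)) (M i)))"

definition supersimple_independence_relation ::
  "'o::wellorder itself \<Rightarrow> ('f, 'r, 'a) aclass \<Rightarrow> ('f, 'r, 'a) struc \<Rightarrow> ('f, 'r, 'a) indep \<Rightarrow> bool"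
  where
  "supersimple_independence_relation ord K C ind \<longleftrightarrow>
     simple_independence_relation ord K C ind \<and> ind_finite_local_character ord K C ind"

definition finite_witness_property_singletons ::
  "('f, 'r, 'a) aclass \<Rightarrow> ('f, 'r, 'a) struc \<Rightarrow> ('f, 'r, 'a) indep \<Rightarrow> bool" where
  "finite_witness_property_singletons K C ind \<longleftrightarrow>
     (\<forall>M N b. small_model K C M \<and> small_model K C N \<and> leK K M N \<and> b \<in> uni C \<longrightarrow>
        (ind {b} M (uni N) \<longleftrightarrow> (\<forall>A. finite A \<and> A \<subseteq> uni N \<longrightarrow> ind {b} M A)))"

section \<open>The rank\<close>

definition forking_extension ::
  "('f, 'r, 'a) aclass \<Rightarrow> ('f, 'r, 'a) struc \<Rightarrow> ('f, 'r, 'a) indep \<Rightarrow>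
     ('f, 'r, 'a) struc \<Rightarrow> ('o::wellorder \<Rightarrow> 'a option) set \<Rightarrow>
     ('f, 'r, 'a) struc \<Rightarrow> ('o \<Rightarrow> 'a option) set \<Rightarrow> bool" where
  "forking_extension K C ind M p N q \<longleftrightarrow>
     leK K M N \<and> p \<in> gS1 K C (uni M) \<and> q \<in> gS1 K C (uni N) \<and>
     grestrict K C q (uni M) = p \<and> \<not> nonforking K C ind q (uni N) M"

text \<open>\<open>U_ge K C ind M p \<alpha>\<close> says that the rank of the type \<open>p\<close> over \<open>M\<close> is at least \<open>\<alpha>\<close>. Every \<open>\<alpha>\<close> is
  of exactly one of the three kinds and the premises only refer to smaller ordinals, so the
  three implications are equivalences and define the predicate by recursion on \<open>\<alpha>\<close>.\<close>

inductive U_ge ::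
  "('f, 'r, 'a) aclass \<Rightarrow> ('f, 'r, 'a) struc \<Rightarrow> ('f, 'r, 'a) indep \<Rightarrow>
     ('f, 'r, 'a) struc \<Rightarrow> ('o::wellorder \<Rightarrow> 'a option) set \<Rightarrow> 'o \<Rightarrow> bool"
  for K C ind where
  zero: "is_zero \<alpha> \<Longrightarrow> U_ge K C ind M p \<alpha>"
| succ: "is_succ \<beta> \<alpha> \<Longrightarrow> small_model K C M' \<Longrightarrow> |uni M'| =o |uni M| \<Longrightarrow>
         forking_extension K C ind M p M' p' \<Longrightarrow> U_ge K C ind M' p' \<beta> \<Longrightarrow> U_ge K C ind M p \<alpha>"
| limit: "is_limit \<alpha> \<Longrightarrow> (\<And>\<beta>. \<beta> < \<alpha> \<Longrightarrow> U_ge K C ind M p \<beta>) \<Longrightarrow> U_ge K C ind M p \<alpha>"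

definition U_infinite ::
  "('f, 'r, 'a) aclass \<Rightarrow> ('f, 'r, 'a) struc \<Rightarrow> ('f, 'r, 'a) indep \<Rightarrow>
     ('f, 'r, 'a) struc \<Rightarrow> ('o::wellorder \<Rightarrow> 'a option) set \<Rightarrow> bool" where
  "U_infinite K C ind M p \<longleftrightarrow> (\<forall>\<alpha>. U_ge K C ind M p \<alpha>)"

end

theory Submission
  imports Defs
begin

text \<open>
  If a type has infinite rank, then so does one of its forking extensions to a model of the same
  size, because the ranks of all types form a set. After moving by automorphisms this gives an
  \<open>\<omega>\<close>-chain of models such that the type of one fixed element forks at every step, and its type
  over the union contradicts finite local character.

  Conversely, let \<open>tp(b/M\<^sub>\<delta>)\<close> fork over every \<open>M\<^sub>i\<close>. By the witness property, for each \<open>i\<close> there is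
  \<open>j < \<delta>\<close> such that \<open>b\<close> is dependent on \<open>M\<^sub>j\<close> over \<open>M\<^sub>i\<close>. The models \<open>M\<^sub>i\<close> may have different sizes, so
  consider models \<open>N \<supseteq> M\<^sub>i\<close> of a fixed large size that are independent from \<open>b M\<^sub>\<delta>\<close> over \<open>M\<^sub>i\<close>. By
  symmetry and base monotonicity \<open>b M\<^sub>\<delta>\<close> is independent from \<open>N M\<^sub>j\<close> over \<open>M\<^sub>j\<close>, and type-amalgamation
  extends \<open>N M\<^sub>j\<close> to such a model \<open>N'\<close> for \<open>j\<close>. By transitivity \<open>b\<close> is dependent on \<open>N'\<close> over \<open>N\<close>.
  Hence, by induction on \<open>\<alpha>\<close>, all types \<open>tp(b/N)\<close> have rank at least \<open>\<alpha>\<close>.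
\<close>

section \<open>Isomorphisms and induced substructures\<close>

lemma struc_iso_inv:
  assumes "struc_iso L h M N"
  shows "struc_iso L (inv_into (uni M) h) N M"
proof -
  let ?g = "inv_into (uni M) h"
  have bij: "bij_betw h (uni M) (uni N)" and M: "is_struc L M" and N: "is_struc L N"
    using assms by (auto simp: struc_iso_def)
  have bij': "bij_betw ?g (uni N) (uni M)" by (rule bij_betw_inv_into[OF bij])
  have map_in: "set (map ?g xs) \<subseteq> uni M" if "set xs \<subseteq> uni N" for xs
    using that bij' by (auto simp: bij_betw_def)
  have map_map: "map h (map ?g xs) = xs" if "set xs \<subseteq> uni N" for xs
    unfolding map_map by (rule map_idI) (use that bij_betw_inv_into_right[OF bij] in auto)
  show ?thesis
    unfolding struc_iso_def
  proof (intro conjI ballI allI impI)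
    fix f xs assume f: "f \<in> funs L" and xs: "set xs \<subseteq> uni N \<and> length xs = farity L f"
    have "h (fint M f (map ?g xs)) = fint N f (map h (map ?g xs))"
      using assms f xs map_in[of xs] unfolding struc_iso_def by (metis length_map)
    then have "h (fint M f (map ?g xs)) = fint N f xs" using map_map xs by metis
    moreover have "fint M f (map ?g xs) \<in> uni M"
      using M f xs map_in[of xs] unfolding is_struc_def by (metis length_map)
    ultimately show "?g (fint N f xs) = fint M f (map ?g xs)"
      using bij_betw_inv_into_left[OF bij] by metis
  next
    fix r xs assume r: "r \<in> rels L" and xs: "set xs \<subseteq> uni N \<and> length xs = rarity L r"
    have "rint M r (map ?g xs) = rint N r (map h (map ?g xs))"
      using assms r xs map_in[of xs] unfolding struc_iso_def by (metis length_map)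
    then show "rint N r xs = rint M r (map ?g xs)" using map_map xs by metis
  qed (use M N bij' in auto)
qed

lemma struc_iso_comp:
  assumes h: "struc_iso L h M N" and g: "struc_iso L g N P"
  shows "struc_iso L (g \<circ> h) M P"
proof -
  have map_in: "set (map h xs) \<subseteq> uni N" if "set xs \<subseteq> uni M" for xs
    using that h by (auto simp: struc_iso_def bij_betw_def)
  show ?thesis
    unfolding struc_iso_def
  proof (intro conjI ballI allI impI)
    fix f xs assume f: "f \<in> funs L" and xs: "set xs \<subseteq> uni M \<and> length xs = farity L f"
    have "h (fint M f xs) = fint N f (map h xs)"
      using h f xs unfolding struc_iso_def by blast
    moreover have "g (fint N f (map h xs)) = fint P f (map g (map h xs))"
      using g f xs map_in[of xs] unfolding struc_iso_def by (metis length_map)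
    ultimately show "(g \<circ> h) (fint M f xs) = fint P f (map (g \<circ> h) xs)" by simp
  next
    fix r xs assume r: "r \<in> rels L" and xs: "set xs \<subseteq> uni M \<and> length xs = rarity L r"
    have "rint M r xs = rint N r (map h xs)"
      using h r xs unfolding struc_iso_def by blast
    moreover have "rint N r (map h xs) = rint P r (map g (map h xs))"
      using g r xs map_in[of xs] unfolding struc_iso_def by (metis length_map)
    ultimately show "rint M r xs = rint P r (map (g \<circ> h) xs)" by simp
  qed (use h g bij_betw_trans in \<open>auto simp: struc_iso_def\<close>)
qed

lemma struc_iso_id_on:
  assumes "is_struc L M" and "\<And>a. a \<in> uni M \<Longrightarrow> h a = a"
  shows "struc_iso L h M M"
proof -
  have "map h xs = xs" if "set xs \<subseteq> uni M" for xs
    by (rule map_idI) (use that assms in auto)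
  moreover have "bij_betw h (uni M) (uni M)"
    using assms(2) by (auto simp: bij_betw_def inj_on_def)
  moreover have "fint M f xs \<in> uni M"
    if "f \<in> funs L" "set xs \<subseteq> uni M" "length xs = farity L f" for f xs
    using assms(1) that unfolding is_struc_def by metis
  ultimately show ?thesis using assms by (simp add: struc_iso_def)
qed

text \<open>The set \<open>X\<close> is not assumed closed under the functions. The default values
  follow the convention of \<open>is_struc\<close>, so that a substructure is literally equal to the
  structure induced on its universe.\<close>

definition restr_struc ::
  "('f, 'r) language \<Rightarrow> ('f, 'r, 'a) struc \<Rightarrow> 'a set \<Rightarrow> ('f, 'r, 'a) struc" where
  "restr_struc L C X =
     \<lparr>uni = X,
      fint = (\<lambda>f xs. if f \<in> funs L \<and> set xs \<subseteq> X \<and> length xs = farity L f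
                     then fint C f xs else undefined),
      rint = (\<lambda>r xs. r \<in> rels L \<and> set xs \<subseteq> X \<and> length xs = rarity L r \<and> rint C r xs)\<rparr>"

lemma uni_restr_struc [simp]: "uni (restr_struc L C X) = X"
  by (simp add: restr_struc_def)

lemma substruc_eq_restr_struc:
  assumes "substruc L M C"
  shows "M = restr_struc L C (uni M)"
proof -
  have "fint M = fint (restr_struc L C (uni M))"
  proof (intro ext)
    fix f xs
    show "fint M f xs = fint (restr_struc L C (uni M)) f xs"
    proof (cases "f \<in> funs L \<and> set xs \<subseteq> uni M \<and> length xs = farity L f")
      case True
      then show ?thesis using assms by (simp add: substruc_def restr_struc_def)
    next
      case False
      then have "fint M f xs = undefined"
        using assms unfolding substruc_def is_struc_def by metis
      with False show ?thesis by (auto simp: restr_struc_def)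
    qed
  qed
  moreover have "rint M = rint (restr_struc L C (uni M))"
  proof (intro ext)
    fix r xs
    have "rint M r xs \<longrightarrow> r \<in> rels L \<and> set xs \<subseteq> uni M \<and> length xs = rarity L r"
      using assms unfolding substruc_def is_struc_def by blast
    moreover have "r \<in> rels L \<and> set xs \<subseteq> uni M \<and> length xs = rarity L r \<longrightarrow>
        rint M r xs = rint C r xs"
      using assms unfolding substruc_def by blast
    ultimately have "rint M r xs \<longleftrightarrow>
        r \<in> rels L \<and> set xs \<subseteq> uni M \<and> length xs = rarity L r \<and> rint C r xs"
      by blast
    then show "rint M r xs = rint (restr_struc L C (uni M)) r xs"
      unfolding restr_struc_def by simp
  qed
  \<comment> \<open>Besides the three fields, record equality compares the extension slot
    \<open>more\<close>, which has type \<open>unit\<close>.\<close>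
  ultimately show ?thesis
    by (intro struc.equality) (rule uni_restr_struc[symmetric], assumption, assumption,
      rule trans[OF unit_eq unit_eq[symmetric]])
qed

lemma struc_iso_restr_struc:
  assumes sub: "substruc L M C" and iso: "struc_iso L h C C'"
  shows "struc_iso L h M (restr_struc L C' (h ` uni M))"
proof -
  have M: "is_struc L M" and MC: "uni M \<subseteq> uni C" using sub by (auto simp: substruc_def)
  have bij: "bij_betw h (uni M) (h ` uni M)"
    using iso MC by (auto simp: struc_iso_def bij_betw_def intro: inj_on_subset)
  have fin: "fint M f xs \<in> uni M"
    if "f \<in> funs L" "set xs \<subseteq> uni M" "length xs = farity L f" for f xs
    using M that unfolding is_struc_def by metis
  have hf: "h (fint M f xs) = fint C' f (map h xs)"
    if "f \<in> funs L" "set xs \<subseteq> uni M" "length xs = farity L f" for f xs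
  proof -
    have "fint M f xs = fint C f xs" using sub that unfolding substruc_def by blast
    moreover have "h (fint C f xs) = fint C' f (map h xs)"
      using iso that order_trans[OF that(2) MC] unfolding struc_iso_def by blast
    ultimately show ?thesis by simp
  qed
  have hr: "rint M r xs = rint C' r (map h xs)"
    if "r \<in> rels L" "set xs \<subseteq> uni M" "length xs = rarity L r" for r xs
  proof -
    have "rint M r xs = rint C r xs" using sub that unfolding substruc_def by blast
    moreover have "rint C r xs = rint C' r (map h xs)"
      using iso that order_trans[OF that(2) MC] unfolding struc_iso_def by blast
    ultimately show ?thesis by simp
  qed
  have "fint C' f ys \<in> h ` uni M"
    if "f \<in> funs L" "set ys \<subseteq> h ` uni M" "length ys = farity L f" for f ys
  proof -
    \<comment> \<open>Lifting \<open>ys\<close> to a list over \<open>uni M\<close> shows that the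
      image is closed under the functions.\<close>
    have "ys \<in> lists (h ` uni M)" using that by auto
    then obtain xs where "set xs \<subseteq> uni M" "ys = map h xs"
      unfolding lists_image by auto
    then show ?thesis using that hf[of f xs] fin[of f xs] by (metis imageI length_map)
  qed
  then have "is_struc L (restr_struc L C' (h ` uni M))"
    using M unfolding is_struc_def restr_struc_def by simp
  moreover have "set (map h xs) \<subseteq> h ` uni M" if "set xs \<subseteq> uni M" for xs using that by auto
  ultimately show ?thesis
    using M bij hf hr unfolding struc_iso_def by (simp add: restr_struc_def)
qed

section \<open>Galois types in the monster model\<close>

lemma ran_map_option_comp: "ran (map_option h \<circ> b) = h ` ran b"
  by (auto simp: ran_def image_iff)

lemma map_option_comp_comp: "map_option g \<circ> (map_option h \<circ> b) = map_option (g \<circ> h) \<circ> b"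
  by (auto simp: fun_eq_iff option.map_comp)

lemma map_option_id_on_ran: "(\<And>a. a \<in> ran b \<Longrightarrow> h a = a) \<Longrightarrow> map_option h \<circ> b = b"
  by (rule ext) (auto intro!: map_option_idI simp: ran_def elem_set)

text \<open>\<open>LEAST x. True\<close> is the ordinal 0, so this is the 1-tuple with entry
  \<open>a\<close>.\<close>

definition point :: "'a \<Rightarrow> 'o::wellorder \<Rightarrow> 'a option" where
  "point a = [(LEAST x. True) \<mapsto> a]"

lemma ran_point [simp]: "ran (point a) = {a}"
  by (simp add: point_def)

lemma dom_point [simp]: "dom (point a) = {LEAST x. True}"
  by (simp add: point_def)

lemma map_option_point: "map_option h \<circ> point a = point (h a)"
  by (auto simp: point_def fun_eq_iff)

lemma point_inject [simp]: "point a = point b \<longleftrightarrow> a = b"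
  by (metis ran_point singleton_inject)

text \<open>Two distinct ordinals make the set minimized in \<open>ord_one\<close> nonempty; its
  least member then has 0 as its only predecessor.\<close>

lemma lessThan_ord_one:
  assumes "\<exists>x y :: 'o::wellorder. x \<noteq> y"
  shows "{..<ord_one :: 'o} = {LEAST x. True}"
proof -
  let ?z = "LEAST x :: 'o. True"
  have z: "?z \<le> x" for x by (rule Least_le) simp
  obtain y :: 'o where "y \<noteq> ?z" using assms by metis
  then have "\<exists>\<alpha> \<beta> :: 'o. \<beta> < \<alpha>" using z by (metis le_imp_less_or_eq)
  then have ex: "\<exists>\<beta> :: 'o. \<beta> < ord_one" unfolding ord_one_def by (rule LeastI_ex)
  have le: "ord_one \<le> \<alpha>" if "\<beta> < \<alpha>" for \<alpha> \<beta> :: 'o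
    unfolding ord_one_def by (rule Least_le) (use that in blast)
  show ?thesis
  proof (intro equalityI subsetI)
    fix x :: 'o assume "x \<in> {..<ord_one}"
    then have "\<not> ?z < x" using le[of ?z x] by auto
    then show "x \<in> {?z}" using z[of x] by auto
  next
    fix x :: 'o assume "x \<in> {?z}"
    then show "x \<in> {..<ord_one}" using ex z le_less_trans by (metis lessThan_iff singletonD)
  qed
qed

lemma is_aecD:
  assumes "is_aec K"
  shows "\<forall>M\<in>mods K. is_struc (lang K) M"
    and "partial_order_on (mods K) {(M, N). leK K M N}"
    and "\<forall>M N. leK K M N \<longrightarrow> substruc (lang K) M N"
    and "\<forall>M N M' N' h. leK K M N \<and> struc_iso (lang K) h N N' \<and> struc_iso (lang K) h M M' \<longrightarrow> leK K M' N'"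
    and "\<forall>M0 M1 M2. leK K M0 M2 \<and> leK K M1 M2 \<and> uni M0 \<subseteq> uni M1 \<longrightarrow> leK K M0 M1"
    and "\<forall>\<C>. \<C> \<subseteq> mods K \<and> \<C> \<noteq> {} \<and> well_order_on \<C> {(M, N). M \<in> \<C> \<and> N \<in> \<C> \<and> leK K M N} \<longrightarrow>
        (\<exists>U\<in>mods K. uni U = (\<Union>M\<in>\<C>. uni M) \<and> (\<forall>M\<in>\<C>. leK K M U) \<and>
           (\<forall>N\<in>mods K. (\<forall>M\<in>\<C>. leK K M N) \<longrightarrow> leK K U N))"
    and "\<exists>\<mu>. LS_bound K \<mu>"
  by (insert assms[unfolded is_aec_def]) (elim conjE, assumption)+

locale aec_monster =
  fixes K :: "('f, 'r, 'a) aclass" and C :: "('f, 'r, 'a) struc"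
  assumes aec: "is_aec K" and monster: "monster_model K C"
begin

section \<open>Strong submodels of the monster and the action of its automorphisms\<close>

abbreviation aut :: "('a \<Rightarrow> 'a) \<Rightarrow> bool" where "aut \<equiv> automorphism K C"

lemma C_in: "C \<in> mods K" using monster by (simp add: monster_model_def)

lemma is_struc_C: "is_struc (lang K) C" using is_aecD(1)[OF aec] C_in by blast

lemma leK_substruc: "leK K M N \<Longrightarrow> substruc (lang K) M N"
  using is_aecD(3)[OF aec] by blast

lemma leK_uni: "leK K M N \<Longrightarrow> uni M \<subseteq> uni N" using leK_substruc by (auto simp: substruc_def)

lemma leK_partial_order: "partial_order_on (mods K) {(M, N). leK K M N}"
  by (rule is_aecD(2)[OF aec])

lemma leK_antisym: "leK K M N \<Longrightarrow> leK K N M \<Longrightarrow> M = N"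
  using leK_partial_order by (auto simp: partial_order_on_def antisym_def)

lemma leK_trans: "leK K M N \<Longrightarrow> leK K N P \<Longrightarrow> leK K M P"
  using leK_partial_order unfolding partial_order_on_def preorder_on_def trans_def by blast

lemma leK_mods: "leK K M N \<Longrightarrow> M \<in> mods K \<and> N \<in> mods K"
  using leK_partial_order unfolding partial_order_on_def preorder_on_def refl_on_def by blast

lemma leK_refl: "M \<in> mods K \<Longrightarrow> leK K M M"
  using leK_partial_order unfolding partial_order_on_def preorder_on_def refl_on_def by blast

lemma leK_coherence: "leK K M C \<Longrightarrow> leK K N C \<Longrightarrow> uni M \<subseteq> uni N \<Longrightarrow> leK K M N"
  using is_aecD(5)[OF aec] by blast

lemma small_modelD:
  assumes "small_model K C M"
  shows "leK K M C" "small_subset C (uni M)" "uni M \<subseteq> uni C" "M \<in> mods K" "is_struc (lang K) M"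
    "leK K M M"
  using assms leK_uni[of M C] leK_mods[of M C] leK_substruc[of M C] leK_refl[of M]
  by (auto simp: small_model_def small_subset_def substruc_def)

text \<open>Both models are strong in \<open>C\<close>, so by coherence only the universes have to
  be compared.\<close>

lemma leK_iff: "small_model K C M \<Longrightarrow> small_model K C N \<Longrightarrow> leK K M N \<longleftrightarrow> uni M \<subseteq> uni N"
  unfolding small_model_def using leK_coherence leK_uni by blast

text \<open>Inclusion holds in both directions, and \<open>leK\<close> is antisymmetric. Small
  models can thus be counted by their universes.\<close>

lemma small_model_eqI:
  assumes "small_model K C M" "small_model K C N" "uni M = uni N"
  shows "M = N"
  using assms leK_iff[of M N] leK_iff[of N M] by (simp add: leK_antisym)

lemma aut_bij: "aut h \<Longrightarrow> bij_betw h (uni C) (uni C)"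
  by (simp add: automorphism_def struc_iso_def)

lemma aut_in: "aut h \<Longrightarrow> a \<in> uni C \<Longrightarrow> h a \<in> uni C"
  using aut_bij by (auto simp: bij_betw_def)

lemma aut_id: "aut id"
  unfolding automorphism_def by (rule struc_iso_id_on) (auto simp: is_struc_C)

lemma aut_comp: "aut h \<Longrightarrow> aut g \<Longrightarrow> aut (g \<circ> h)"
  unfolding automorphism_def by (rule struc_iso_comp)

text \<open>Only the values of \<open>h\<close> on \<open>uni C\<close> are controlled, hence
  \<open>inv_into\<close> on that set.\<close>

definition ainv :: "('a \<Rightarrow> 'a) \<Rightarrow> 'a \<Rightarrow> 'a" where "ainv h = inv_into (uni C) h"

lemma aut_ainv: "aut h \<Longrightarrow> aut (ainv h)"
  unfolding automorphism_def ainv_def by (rule struc_iso_inv)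

lemma ainv_left: "aut h \<Longrightarrow> a \<in> uni C \<Longrightarrow> ainv h (h a) = a"
  using aut_bij unfolding ainv_def by (metis bij_betw_inv_into_left)

lemma ainv_image: "aut h \<Longrightarrow> A \<subseteq> uni C \<Longrightarrow> ainv h ` h ` A = A"
  by (force simp: ainv_left image_iff subset_iff)

lemma card_of_aut_image:
  assumes "aut h" "A \<subseteq> uni C" shows "|h ` A| =o |A|"
proof -
  have "inj_on h A" using assms aut_bij by (meson bij_betw_def inj_on_subset)
  then have "bij_betw h A (h ` A)" by (rule inj_on_imp_bij_betw)
  then show ?thesis using card_of_ordIsoI ordIso_symmetric by blast
qed

lemma small_subset_aut_image:
  assumes "aut h" "small_subset C A" shows "small_subset C (h ` A)"
  using assms card_of_aut_image[of h A] aut_in[OF assms(1)]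
  unfolding small_subset_def small_def by (auto intro: ordIso_ordLess_trans)

definition aut_model :: "('a \<Rightarrow> 'a) \<Rightarrow> ('f, 'r, 'a) struc \<Rightarrow> ('f, 'r, 'a) struc" where
  "aut_model h M = restr_struc (lang K) C (h ` uni M)"

lemma uni_aut_model [simp]: "uni (aut_model h M) = h ` uni M"
  by (simp add: aut_model_def)

lemma aut_model_iso:
  assumes "aut h" "small_model K C M"
  shows "struc_iso (lang K) h M (aut_model h M)"
  unfolding aut_model_def using assms leK_substruc
  by (intro struc_iso_restr_struc) (auto simp: small_model_def automorphism_def)

text \<open>Closure of \<open>leK\<close> under isomorphism is applied to the pair \<open>M\<close>,
  \<open>C\<close> with \<open>h\<close> acting on both; \<open>C\<close> goes to itself.\<close>

lemma small_aut_model: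
  assumes "aut h" "small_model K C M"
  shows "small_model K C (aut_model h M)"
proof -
  have "leK K (aut_model h M) C"
    using is_aecD(4)[OF aec] aut_model_iso[OF assms] assms
    unfolding small_model_def automorphism_def by blast
  then show ?thesis
    using small_subset_aut_image[OF assms(1)] small_modelD(2)[OF assms(2)]
    by (simp add: small_model_def small_subset_def)
qed

lemma aut_model_eq:
  assumes "small_model K C M" "small_model K C N" "uni N = h ` uni M"
  shows "aut_model h M = N"
  using substruc_eq_restr_struc[OF leK_substruc[OF small_modelD(1)[OF assms(2)]]] assms(3)
  by (simp add: aut_model_def)

section \<open>Equality of Galois types as conjugacy over the parameters\<close>

lemma self_in_gtp: "b \<in> gtp K C b A"
  unfolding gtp_def using aut_id by (force simp: option.map_id0)

lemma gtp_subset: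
  assumes "aut h" "\<forall>a\<in>A. h a = a" "A \<subseteq> uni C"
  shows "gtp K C (map_option h \<circ> b) A \<subseteq> gtp K C b A"
proof
  fix c assume "c \<in> gtp K C (map_option h \<circ> b) A"
  then obtain g where g: "aut g" "\<forall>a\<in>A. g a = a" "c = map_option g \<circ> (map_option h \<circ> b)"
    by (auto simp: gtp_def)
  then show "c \<in> gtp K C b A" unfolding gtp_def map_option_comp_comp
    using aut_comp[OF assms(1) g(1)] assms(2) by fastforce
qed

lemma gtp_eqI:
  assumes "aut h" "\<forall>a\<in>A. h a = a" "A \<subseteq> uni C" "ran b \<subseteq> uni C"
  shows "gtp K C (map_option h \<circ> b) A = gtp K C b A"
proof
  \<comment> \<open>The inclusion \<open>gtp_subset\<close> is used a second time, for
    \<open>ainv h\<close> and the moved tuple.\<close>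
  have "map_option (ainv h) \<circ> (map_option h \<circ> b) = b"
    unfolding map_option_comp_comp
    by (rule map_option_id_on_ran) (use assms ainv_left in auto)
  moreover have "\<forall>a\<in>A. ainv h a = a" using assms ainv_left by (metis subset_iff)
  ultimately show "gtp K C b A \<subseteq> gtp K C (map_option h \<circ> b) A"
    using gtp_subset[OF aut_ainv[OF assms(1)] _ assms(3), of "map_option h \<circ> b"] by simp
qed (rule gtp_subset[OF assms(1-3)])

lemma gtp_eq_iff:
  assumes "A \<subseteq> uni C" "ran b \<subseteq> uni C"
  shows "gtp K C b A = gtp K C c A \<longleftrightarrow> (\<exists>h. aut h \<and> (\<forall>a\<in>A. h a = a) \<and> c = map_option h \<circ> b)"
proof
  assume "gtp K C b A = gtp K C c A"
  then have "c \<in> gtp K C b A" using self_in_gtp by blast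
  then show "\<exists>h. aut h \<and> (\<forall>a\<in>A. h a = a) \<and> c = map_option h \<circ> b" by (auto simp: gtp_def)
qed (use gtp_eqI assms in auto)

text \<open>\<open>grestrict\<close> unites the types over \<open>A\<close> of all realizations;
  these types coincide because the realizations are conjugate over the larger set
  \<open>B\<close>.\<close>

lemma grestrict_gtp:
  assumes "A \<subseteq> B" "B \<subseteq> uni C" "ran b \<subseteq> uni C"
  shows "grestrict K C (gtp K C b B) A = gtp K C b A"
proof -
  have "gtp K C c A = gtp K C b A" if c: "c \<in> gtp K C b B" for c
  proof -
    obtain h where "aut h" "\<forall>a\<in>B. h a = a" "c = map_option h \<circ> b"
      using c by (auto simp: gtp_def)
    then show ?thesis using gtp_eqI[of h A b] assms by blast
  qed
  then show ?thesis unfolding grestrict_def using self_in_gtp by blast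
qed

end

section \<open>Cardinals and initial segments\<close>

text \<open>A cardinal order is the shortest well-order on its set, so \<open>r\<close> is also
  shorter than the given order \<open>W\<close> of \<open>'o\<close> and hence isomorphic to a
  proper initial segment of it.\<close>

lemma lessThan_iso:
  fixes r :: "'b rel"
  assumes r: "Well_order r" and less: "r <o |UNIV :: 'o::wellorder set|"
  shows "\<exists>(\<alpha> :: 'o) f. bij_betw f (Field r) {..<\<alpha>} \<and>
    (\<forall>x\<in>Field r. \<forall>y\<in>Field r. (x, y) \<in> r \<longleftrightarrow> f x \<le> f y)"
proof -
  define W where "W = {(x :: 'o, y). x \<le> y}"
  have Field_W: "Field W = UNIV" by (auto simp: W_def Field_def)
  have "W - Id = {(x, y). x < y}" by (auto simp: W_def)
  then have "wf (W - Id)" using wf by simp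
  moreover have "linear_order_on UNIV W"
    by (auto simp: W_def linear_order_on_def partial_order_on_def preorder_on_def refl_on_def
        trans_def antisym_def total_on_def)
  ultimately have W: "Well_order W" unfolding Field_W well_order_on_def by simp
  then have "|UNIV :: 'o set| \<le>o W" using card_of_least[of UNIV W] Field_W by simp
  with less have "r <o W" by (rule ordLess_ordLeq_trans)
  then obtain \<alpha> where iso: "r =o Restr W (underS W \<alpha>)"
    using ordLess_iff_ordIso_Restr[OF W r] by blast
  have under: "underS W \<alpha> = {..<\<alpha>}" by (auto simp: underS_def W_def)
  have Field: "Field (Restr W {..<\<alpha>}) = {..<\<alpha>}" by (auto simp: Field_def W_def)
  obtain f where "iso r (Restr W {..<\<alpha>}) f" using iso under by (auto simp: ordIso_def)
  then have f: "bij_betw f (Field r) {..<\<alpha>}"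
    "\<And>x y. x \<in> Field r \<Longrightarrow> y \<in> Field r \<Longrightarrow> (x, y) \<in> r \<longleftrightarrow> (f x, f y) \<in> Restr W {..<\<alpha>}"
    unfolding iso_iff2 Field by auto
  then have "(x, y) \<in> r \<longleftrightarrow> f x \<le> f y" if "x \<in> Field r" "y \<in> Field r" for x y
    using that f(2)[OF that] by (auto simp: W_def bij_betw_def)
  with f(1) show ?thesis by blast
qed

lemma enumerate_by_ordinal:
  assumes "|T| <o |UNIV :: 'o::wellorder set|"
  obtains \<alpha> :: "'o::wellorder" and t where "dom t = {..<\<alpha>}" "ran t = T" "|{..<\<alpha>}| =o |T|"
proof -
  obtain \<alpha> :: 'o and f where f: "bij_betw f T {..<\<alpha>}"
    using lessThan_iso[OF card_of_Well_order assms] Field_card_of by metis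
  define t where "t i = (if i < \<alpha> then Some (inv_into T f i) else None)" for i
  have "dom t = {..<\<alpha>}" by (auto simp: t_def dom_def)
  moreover have "bij_betw (inv_into T f) {..<\<alpha>} T" by (rule bij_betw_inv_into[OF f])
  moreover have "ran t = inv_into T f ` {..<\<alpha>}"
    unfolding t_def ran_def by (auto split: if_splits)
  ultimately have t: "dom t = {..<\<alpha>}" "ran t = T" by (auto simp: bij_betw_def)
  have "|{..<\<alpha>}| =o |T|" using f card_of_ordIsoI ordIso_symmetric by blast
  with t show ?thesis using that by blast
qed

text \<open>This is \<open>lessThan_iso\<close> for \<open>natLeq\<close>: \<open>e\<close>
  enumerates the finite ordinals of \<open>'o\<close>, and \<omega> is the first ordinal above
  them.\<close>

lemma exists_omega:
  assumes "|UNIV :: nat set| <o |UNIV :: 'o::wellorder set|"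
  obtains \<omega> :: "'o::wellorder" and e :: "nat \<Rightarrow> 'o" where "strict_mono e" "range e = {..<\<omega>}"
proof -
  have "natLeq <o |UNIV :: 'o set|"
    using assms card_of_nat ordIso_ordLess_trans ordIso_symmetric by blast
  from lessThan_iso[OF natLeq_Well_order this]
  obtain \<omega> :: 'o and e where e: "bij_betw e UNIV {..<\<omega>}" "\<And>x y. (x, y) \<in> natLeq \<longleftrightarrow> e x \<le> e y"
    unfolding Field_natLeq by blast
  have "strict_mono e" unfolding strict_mono_def using e(2) by (simp add: natLeq_def not_le[symmetric])
  moreover have "range e = {..<\<omega>}" using e(1) by (simp add: bij_betw_def)
  ultimately show ?thesis using that by blast
qed

text \<open>A predecessor of \<omega> would be some \<open>e n\<close>, but \<open>e (Suc n)\<close>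
  lies strictly between.\<close>

lemma is_limit_omega:
  fixes \<omega> :: "'o::wellorder" and e :: "nat \<Rightarrow> 'o"
  assumes e: "strict_mono e" "range e = {..<\<omega>}"
  shows "is_limit \<omega>"
proof -
  have lt: "e n < \<omega>" for n using e(2) by auto
  then have "\<not> is_zero \<omega>" using leD unfolding is_zero_def by blast
  moreover have "\<not> is_succ \<beta> \<omega>" for \<beta>
  proof
    assume succ: "is_succ \<beta> \<omega>"
    then obtain n where "\<beta> = e n" using e(2) unfolding is_succ_def by (metis lessThan_iff rangeE)
    moreover have "e n < e (Suc n)" using e(1) by (simp add: strict_mono_def)
    ultimately show False using succ lt[of "Suc n"] unfolding is_succ_def by (meson leD)
  qed
  ultimately show ?thesis by (auto simp: is_limit_def)
qed

text \<open>Each \<open>e n\<close> is 0 or the successor of the previous value. So a chain of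
  length \<omega> has to be continuous only at its top.\<close>

lemma not_is_limit_below_omega:
  fixes \<omega> :: "'o::wellorder" and e :: "nat \<Rightarrow> 'o"
  assumes e: "strict_mono e" "range e = {..<\<omega>}"
  shows "\<not> is_limit (e n)"
proof (cases n)
  case 0
  have "e 0 \<le> \<beta>" for \<beta>
  proof (cases "\<beta> < \<omega>")
    case True
    then obtain m where "\<beta> = e m" using e(2) by (metis lessThan_iff rangeE)
    then show ?thesis using e(1) by (simp add: strict_mono_less_eq)
  next
    case False
    moreover have "e 0 < \<omega>" using e(2) by auto
    ultimately show ?thesis by simp
  qed
  then show ?thesis using 0 by (simp add: is_limit_def is_zero_def)
next
  case (Suc m)
  have "e (Suc m) \<le> \<gamma>" if "e m < \<gamma>" for \<gamma>
  proof (cases "\<gamma> < \<omega>")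
    case True
    then obtain k where "\<gamma> = e k" using e(2) by (metis lessThan_iff rangeE)
    then show ?thesis using e(1) that by (simp add: strict_mono_less_eq strict_mono_less Suc_le_eq)
  next
    case False
    moreover have "e (Suc m) < \<omega>" using e(2) by auto
    ultimately show ?thesis by simp
  qed
  then have "is_succ (e m) (e (Suc m))" using e(1) by (simp add: is_succ_def strict_mono_def)
  then show ?thesis using Suc by (auto simp: is_limit_def)
qed

lemma ordinal_cases:
  fixes \<alpha> :: "'o::wellorder"
  obtains (zero) "is_zero \<alpha>" | (succ) \<beta> where "is_succ \<beta> \<alpha>" | (limit) "is_limit \<alpha>"
  unfolding is_limit_def by blast

section \<open>Small models of prescribed size and unions of countable chains\<close>

context aec_monster
begin

text \<open>\<open>LS K\<close> is chosen by \<open>SOME\<close> among the least bounds; one exists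
  because cardinals are well-ordered by \<open>\<le>o\<close>.\<close>

lemma LS_bound_LS: "LS_bound K (LS K)"
proof -
  let ?R = "{\<mu>. LS_bound K \<mu>}"
  have "?R \<noteq> {}" using is_aecD(7)[OF aec] by simp
  moreover have "\<forall>\<mu>\<in>?R. Well_order \<mu>"
    using card_order_on_well_order_on by (auto simp: LS_bound_def)
  ultimately have "\<exists>\<mu>\<in>?R. \<forall>\<nu>\<in>?R. \<mu> \<le>o \<nu>" by (rule exists_minim_Well_order)
  then have "\<exists>\<mu>. LS_bound K \<mu> \<and> (\<forall>\<nu>. LS_bound K \<nu> \<longrightarrow> \<mu> \<le>o \<nu>)" by auto
  then show ?thesis unfolding LS_def by (rule someI2_ex) auto
qed

lemma LS_less: "LS K <o |uni C|" using monster by (simp add: monster_model_def)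

lemma nat_ordLeq_LS: "|UNIV :: nat set| \<le>o LS K"
  using LS_bound_LS by (simp add: LS_bound_def)

lemma infinite_C: "infinite (uni C)"
  unfolding infinite_iff_card_of_nat
  by (rule ordLess_imp_ordLeq[OF ordLeq_ordLess_trans[OF nat_ordLeq_LS LS_less]])

lemma small_subset_Un: "small_subset C A \<Longrightarrow> small_subset C B \<Longrightarrow> small_subset C (A \<union> B)"
  using infinite_C card_of_Un_ordLess_infinite unfolding small_subset_def small_def by blast

lemma small_singleton: "b \<in> uni C \<Longrightarrow> small_subset C {b}"
  using infinite_C finite_ordLess_infinite[of "|{b}|" "|uni C|"]
  by (simp add: small_subset_def small_def Field_card_of card_of_well_order_on)

text \<open>A subset of \<open>uni C\<close> of size \<open>LS K\<close> is adjoined, so that the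
  Loewenheim-Skolem property yields models of exactly the size of \<open>S\<close>.\<close>

lemma large_small_superset:
  assumes "small_subset C A"
  obtains S where "A \<subseteq> S" "small_subset C S" "infinite S" "LS K \<le>o |S|"
proof -
  have card: "Card_order (LS K)" using LS_bound_LS by (simp add: LS_bound_def)
  then have iso: "|Field (LS K)| =o LS K" by (rule card_of_Field_ordIso)
  then have "|Field (LS K)| \<le>o |uni C|"
    using LS_less by (meson ordIso_ordLess_trans ordLess_imp_ordLeq)
  then obtain B where B: "B \<subseteq> uni C" "|Field (LS K)| =o |B|"
    using internalize_card_of_ordLeq2 by metis
  then have LSB: "LS K =o |B|" using iso by (meson ordIso_symmetric ordIso_transitive)
  then have "small_subset C B"
    using B LS_less by (auto simp: small_subset_def small_def intro: ordIso_ordLess_trans ordIso_symmetric)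
  moreover have B_le: "|B| \<le>o |A \<union> B|" by (simp add: card_of_mono1)
  then have "LS K \<le>o |A \<union> B|" using LSB ordIso_ordLeq_trans by blast
  moreover then have "infinite (A \<union> B)"
    using nat_ordLeq_LS infinite_iff_card_of_nat ordLeq_transitive by blast
  ultimately show ?thesis using that[of "A \<union> B"] small_subset_Un assms by blast
qed

text \<open>\<open>LS K\<close> is absorbed by \<open>|S|\<close>, so the Loewenheim-Skolem bound
  becomes \<open>|S|\<close>.\<close>

lemma exists_model_of_card:
  assumes "small_subset C S" "infinite S" "LS K \<le>o |S|"
  obtains N where "small_model K C N" "S \<subseteq> uni N" "|uni N| =o |S|"
proof -
  obtain N where N: "leK K N C" "S \<subseteq> uni N" "|uni N| \<le>o |S| +c LS K"
    using LS_bound_LS C_in assms(1) unfolding LS_bound_def small_subset_def by blast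
  have "|S| +c LS K =o |S|"
    by (rule csum_absorb1) (use assms card_of_Card_order in \<open>auto simp: cinfinite_def Field_card_of\<close>)
  then have le: "|uni N| \<le>o |S|" using N(3) ordLeq_ordIso_trans by blast
  moreover have "|S| \<le>o |uni N|" using N(2) by (simp add: card_of_mono1)
  ultimately have "|uni N| =o |S|" by (simp add: ordIso_iff_ordLeq)
  moreover have "small_model K C N"
    using N(1) le assms(1) ordLeq_ordLess_trans
    unfolding small_model_def small_def small_subset_def by blast
  ultimately show ?thesis using that N(2) by blast
qed

text \<open>The equal sizes bound the union by one small infinite cardinal; nothing is assumed about
  the cofinality of the size of the monster.\<close>

lemma union_of_chain:
  fixes N :: "nat \<Rightarrow> ('f, 'r, 'a) struc"
  assumes N: "\<And>n. small_model K C (N n)" and step: "\<And>n. leK K (N n) (N (Suc n))"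
    and card: "\<And>n. |uni (N n)| =o |uni (N 0)|"
  obtains U where "small_model K C U" "uni U = (\<Union>n. uni (N n))"
proof -
  have mono: "leK K (N m) (N n)" if "m \<le> n" for m n
    using that
  proof (induction rule: dec_induct)
    case base show ?case using small_modelD(6)[OF N] .
  next
    case (step n) then show ?case using assms(2) leK_trans by blast
  qed
  let ?C = "range N"
  let ?r = "{(M, M'). M \<in> ?C \<and> M' \<in> ?C \<and> leK K M M'}"
  \<comment> \<open>\<open>N\<close> may have repetitions; comparing the least indices of the models
    shows that the strict order on the range is well-founded.\<close>
  define ix where "ix M = (LEAST n. N n = M)" for M
  have ix: "N (ix M) = M" if "M \<in> ?C" for M
    unfolding ix_def by (rule LeastI_ex) (use that in blast)
  have "linear_order_on ?C ?r"
    unfolding linear_order_on_def partial_order_on_def preorder_on_def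
  proof (intro conjI)
    show "refl_on ?C ?r" unfolding refl_on_def using mono by auto
    show "trans ?r" unfolding trans_def using leK_trans by blast
    show "antisym ?r" unfolding antisym_def using leK_antisym by blast
    show "total_on ?C ?r" unfolding total_on_def using mono nat_le_linear by blast
  qed blast
  moreover have "?r - Id \<subseteq> inv_image less_than ix"
  proof
    fix x assume "x \<in> ?r - Id"
    then obtain M M' where M: "x = (M, M')" "M \<in> ?C" "M' \<in> ?C" "leK K M M'" "M \<noteq> M'" by auto
    have "\<not> ix M' \<le> ix M"
      using mono[of "ix M'" "ix M"] ix M leK_antisym by auto
    then show "x \<in> inv_image less_than ix" using M(1) by simp
  qed
  then have "wf (?r - Id)" using wf_inv_image wf_less_than wf_subset by blast
  ultimately have "well_order_on ?C ?r" by (simp add: well_order_on_def)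
  moreover have "?C \<subseteq> mods K" using small_modelD(4)[OF N] by blast
  ultimately have "?C \<subseteq> mods K \<and> ?C \<noteq> {} \<and> well_order_on ?C ?r" by simp
  from mp[OF spec[OF is_aecD(6)[OF aec]] this]
  obtain U where U: "uni U = (\<Union>M\<in>?C. uni M)"
      "\<forall>M\<in>mods K. (\<forall>M'\<in>?C. leK K M' M) \<longrightarrow> leK K U M"
    by (elim bexE conjE)
  \<comment> \<open>\<open>C\<close> is itself an upper bound of the chain, so the union is strong
    in \<open>C\<close>.\<close>
  have "leK K U C" using bspec[OF U(2) C_in] small_modelD(1)[OF N] by blast
  moreover obtain S where S: "uni (N 0) \<subseteq> S" "small_subset C S" "infinite S"
    using large_small_superset[OF small_modelD(2)[OF N]] by metis
  have "|uni (N n)| \<le>o |S|" for n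
    using card card_of_mono1[OF S(1)] ordIso_ordLeq_trans by blast
  then have "|\<Union>n. uni (N n)| \<le>o |S|"
    using S(3) infinite_iff_card_of_nat by (intro card_of_UNION_ordLeq_infinite) auto
  then have "small C (uni U)"
    using S(2) U(1) ordLeq_ordLess_trans by (auto simp: small_def small_subset_def)
  ultimately show ?thesis using that U(1) by (simp add: small_model_def)
qed

end

section \<open>Independence and automorphisms\<close>

text \<open>The assumption \<open>large\<close> provides ordinals to enumerate small sets, a copy of
  \<omega>, and more ordinals than pairs of a model and an element.\<close>

locale simple_monster = aec_monster K C
  for K :: "('f, 'r, 'a) aclass" and C :: "('f, 'r, 'a) struc" +
  fixes ord :: "'o::wellorder itself" and ind :: "('f, 'r, 'a) indep"
  assumes simple: "simple_independence_relation ord K C ind"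
    and large: "|UNIV :: 'a set set| <o |UNIV :: 'o set|"
begin

lemma ind_rel: "independence_relation ord K C ind"
  using simple by (simp add: simple_independence_relation_def)

lemma ind_aut:
  assumes "aut h" "small_model K C M" "small_subset C A" "small_subset C B" "ind A M B"
  shows "ind (h ` A) (aut_model h M) (h ` B)"
proof -
  have "ind_invariance K C ind" using ind_rel by (simp add: independence_relation_def)
  then show ?thesis using assms aut_model_iso[OF assms(1,2)] unfolding ind_invariance_def by blast
qed

lemma ind_mono:
  assumes "ind A M B" "small_model K C M" "small_subset C A" "small_subset C B"
    "A' \<subseteq> A" "B' \<subseteq> B"
  shows "ind A' M B'"
proof -
  have "ind_monotonicity K C ind" using ind_rel by (simp add: independence_relation_def)
  then show ?thesis using assms unfolding ind_monotonicity_def by blast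
qed

text \<open>Normality adds the base on both sides, and monotonicity removes it on the left.\<close>

lemma ind_normal:
  assumes "ind A M B" "small_model K C M" "small_subset C A" "small_subset C B"
  shows "ind A M (B \<union> uni M)"
proof -
  have "ind_normality K C ind" using ind_rel by (simp add: independence_relation_def)
  then have "ind (A \<union> uni M) M (B \<union> uni M)" using assms unfolding ind_normality_def by blast
  then show ?thesis
    by (rule ind_mono) (use assms small_subset_Un small_modelD(2) in auto)
qed

lemma ind_base_mono:
  assumes "ind A M B" "small_model K C M" "small_model K C N" "small_subset C A" "small_subset C B"
    "uni M \<subseteq> uni N" "uni N \<subseteq> B"
  shows "ind A N B"
proof -
  have "ind_base_monotonicity K C ind" using ind_rel by (simp add: independence_relation_def)
  moreover have "leK K M N" using assms leK_iff by simp
  ultimately show ?thesis using assms unfolding ind_base_monotonicity_def by blast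
qed

lemma ind_trans:
  assumes "ind A M (uni N)" "ind A N B" "small_model K C M" "small_model K C N"
    "small_subset C A" "small_subset C B" "uni M \<subseteq> uni N"
  shows "ind A M B"
proof -
  have "ind_transitivity K C ind" using ind_rel by (simp add: independence_relation_def)
  moreover have "leK K M N" using assms leK_iff by simp
  ultimately show ?thesis using assms unfolding ind_transitivity_def by blast
qed

lemma ind_sym:
  assumes "ind A M B" "small_model K C M" "small_subset C A" "small_subset C B"
  shows "ind B M A"
proof -
  have "ind_symmetry K C ind" using simple by (simp add: simple_independence_relation_def)
  then show ?thesis using assms unfolding ind_symmetry_def by blast
qed

lemma ind_aut_iff:
  assumes "aut h" "small_model K C M" "small_subset C A" "small_subset C B"
  shows "ind (h ` A) (aut_model h M) (h ` B) \<longleftrightarrow> ind A M B"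
proof
  assume "ind (h ` A) (aut_model h M) (h ` B)"
  then have "ind (ainv h ` h ` A) (aut_model (ainv h) (aut_model h M)) (ainv h ` h ` B)"
    by (rule ind_aut[rotated -1]) (use assms aut_ainv small_aut_model small_subset_aut_image in auto)
  moreover have "aut_model (ainv h) (aut_model h M) = M"
    by (rule aut_model_eq)
      (use assms small_aut_model ainv_image[OF assms(1) small_modelD(3)[OF assms(2)]] in auto)
  moreover have "A \<subseteq> uni C" "B \<subseteq> uni C" using assms by (auto simp: small_subset_def)
  ultimately show "ind A M B" using ainv_image[OF assms(1)] by metis
qed (rule ind_aut[OF assms])

lemma ind_aut_fix_iff:
  assumes "aut h" "small_model K C M" "small_subset C A" "small_subset C B" "\<forall>a\<in>uni M. h a = a"
  shows "ind (h ` A) M (h ` B) \<longleftrightarrow> ind A M B"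
proof -
  have "aut_model h M = M" by (rule aut_model_eq[OF assms(2,2)]) (use assms(5) in force)
  then show ?thesis using ind_aut_iff[OF assms(1-4)] by simp
qed

text \<open>\<open>nonforking\<close> asks for one suitable realization; all realizations are
  conjugate over \<open>B\<close>, which contains the base, so by invariance any of them
  decides.\<close>

lemma nonforking_iff:
  fixes t :: "'i \<Rightarrow> 'a option"
  assumes "small_model K C M" "small_subset C B" "uni M \<subseteq> B" "small_subset C (ran t)"
  shows "nonforking K C ind (gtp K C t B) B M \<longleftrightarrow> ind (ran t) M B"
proof
  assume "nonforking K C ind (gtp K C t B) B M"
  then obtain b where b: "gtp K C t B = gtp K C b B" "ind (ran b) M B"
    by (auto simp: nonforking_def)
  have "B \<subseteq> uni C" "ran t \<subseteq> uni C" using assms by (auto simp: small_subset_def)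
  from b(1)[unfolded gtp_eq_iff[OF this]]
  obtain h where h: "aut h" "\<forall>a\<in>B. h a = a" "b = map_option h \<circ> t" by blast
  have "h ` B = B" using h(2) by force
  then have "ind (h ` ran t) M (h ` B)" using b(2) h(3) by (simp add: ran_map_option_comp)
  then show "ind (ran t) M B" using ind_aut_fix_iff[OF h(1) assms(1,4,2)] h(2) assms(3) by blast
qed (auto simp: nonforking_def)

lemma small_ordLess: "small_subset C T \<Longrightarrow> |T| <o |UNIV :: 'o set|"
proof -
  assume "small_subset C T"
  have "|T| \<le>o |UNIV :: 'a set|" by (simp add: card_of_mono1)
  moreover have "|UNIV :: 'a set| <o |UNIV :: 'a set set|" using card_of_Pow[of UNIV] by simp
  ultimately show ?thesis using large by (meson ordLeq_ordLess_trans ordLess_transitive)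
qed

text \<open>Existence and type-amalgamation speak of types of tuples; enumerating a set makes them
  available for sets.\<close>

lemma enumerate_small:
  assumes "small_subset C T"
  obtains t :: "'o \<Rightarrow> 'a option" where "ran t = T" "\<And>A. gtp K C t A \<in> gS_all K C A"
proof -
  obtain \<alpha> :: 'o and t where t: "dom t = {..<\<alpha>}" "ran t = T" "|{..<\<alpha>}| =o |T|"
    using enumerate_by_ordinal[OF small_ordLess[OF assms]] by metis
  have "small C {..<\<alpha>}"
    using assms t(3) unfolding small_def small_subset_def by (meson ordIso_ordLess_trans)
  moreover have "gtp K C t A \<in> gS K C \<alpha> A" for A
    using t assms by (auto simp: gS_def small_subset_def)
  ultimately show ?thesis using that[OF t(2)] by (auto simp: gS_all_def)
qed

text \<open>Membership only gives some representative inside \<open>C\<close>; any other one is its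
  image under an automorphism.\<close>

lemma gS_all_ran:
  assumes "gtp K C b A \<in> gS_all K C A" shows "ran b \<subseteq> uni C"
proof -
  obtain c where c: "gtp K C b A = gtp K C c A" "ran c \<subseteq> uni C"
    using assms by (auto simp: gS_all_def gS_def)
  then have "b \<in> gtp K C c A" using self_in_gtp by metis
  then obtain h where "aut h" "b = map_option h \<circ> c" by (auto simp: gtp_def)
  then show ?thesis using c(2) aut_in by (auto simp: ran_map_option_comp)
qed

text \<open>Existence is applied with both models equal to \<open>M\<close>; the extension it gives
  is then the type itself.\<close>

lemma ind_base:
  assumes T: "small_subset C T" and M: "small_model K C M"
  shows "ind T M (uni M)"
proof -
  obtain t :: "'o \<Rightarrow> 'a option" where t: "ran t = T" "\<And>A. gtp K C t A \<in> gS_all K C A"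
    using enumerate_small[OF T] by metis
  have "ind_existence ord K C ind" using ind_rel by (simp add: independence_relation_def)
  then obtain q where q: "q \<in> gS_all K C (uni M)"
      "grestrict K C q (uni M) = gtp K C t (uni M)" "nonforking K C ind q (uni M) M"
    using M t(2) small_modelD(6)[OF M] unfolding ind_existence_def by blast
  then obtain b where b: "q = gtp K C b (uni M)" by (auto simp: nonforking_def)
  have "q = gtp K C t (uni M)"
    using q(2) grestrict_gtp[OF subset_refl small_modelD(3)[OF M]] gS_all_ran q(1) unfolding b
    by metis
  then show ?thesis
    using q(3) nonforking_iff[OF M small_modelD(2)[OF M] subset_refl, of t] t(1) T by simp
qed

text \<open>Independent extension over a parameter set which is not a model: amalgamate the type over
  \<open>A\<close> with its own restriction to \<open>M\<close>.\<close>

lemma extend_independent: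
  assumes M: "small_model K C M" and T: "small_subset C T" and A: "small_subset C A"
    and MA: "uni M \<subseteq> A" and ind: "ind T M A" and N: "small_model K C N" and AN: "A \<subseteq> uni N"
  obtains N' where "small_model K C N'" "A \<subseteq> uni N'" "|uni N'| =o |uni N|" "ind T M (uni N')"
proof -
  obtain t :: "'o \<Rightarrow> 'a option" where t: "ran t = T" "\<And>A. gtp K C t A \<in> gS_all K C A"
    using enumerate_small[OF T] by metis
  have AC: "A \<subseteq> uni C" and TC: "T \<subseteq> uni C" using A T by (auto simp: small_subset_def)
  have MC: "small_subset C (uni M)" by (rule small_modelD(2)[OF M])
  have NC: "small_subset C (uni N)" by (rule small_modelD(2)[OF N])
  have "nonforking K C ind (gtp K C t A) A M"
    using nonforking_iff[OF M A MA, of t] t(1) T ind by simp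
  moreover have "nonforking K C ind (gtp K C t (uni M)) (uni M) M"
    using nonforking_iff[OF M MC subset_refl, of t] t(1) T ind_base[OF T M] by simp
  moreover have "grestrict K C (gtp K C t A) (uni M) = gtp K C t (uni M)"
    "grestrict K C (gtp K C t (uni M)) (uni M) = gtp K C t (uni M)"
    using grestrict_gtp[of _ _ t] MA AC TC t(1) small_modelD(3)[OF M] by auto
  moreover have "ind_type_amalgamation ord K C ind"
    using simple by (simp add: simple_independence_relation_def)
  moreover have "A \<union> uni M \<subseteq> uni N" using MA AN by auto
  \<comment> \<open>The two parameter sets are \<open>A\<close> and \<open>uni M\<close>; their
    independence over \<open>M\<close> is \<open>ind_base\<close> for \<open>A\<close>.\<close>
  ultimately obtain q where q: "q \<in> gS_all K C (uni N)" "grestrict K C q A = gtp K C t A"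
      "nonforking K C ind q (uni N) M"
    using M A MC N t(2) MA subset_refl ind_base[OF A M]
    unfolding ind_type_amalgamation_def by meson
  then obtain b where b: "q = gtp K C b (uni N)" "ind (ran b) M (uni N)"
    by (auto simp: nonforking_def)
  have "gtp K C t A = gtp K C b A"
    using q(2) grestrict_gtp[OF AN small_modelD(3)[OF N]] gS_all_ran q(1) unfolding b by metis
  then obtain h where h: "aut h" "\<forall>a\<in>A. h a = a" "b = map_option h \<circ> t"
    using gtp_eq_iff[OF AC, of t b] TC t(1) by blast
  \<comment> \<open>Pulling the realization \<open>b\<close> back to \<open>t\<close> over
    \<open>A\<close> moves \<open>N\<close> to the desired model.\<close>
  let ?g = "ainv h"
  have g: "aut ?g" "\<forall>a\<in>A. ?g a = a" using h AC aut_ainv ainv_left by (auto, metis subset_iff)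
  have "ran b = h ` T" using h(3) t(1) by (simp add: ran_map_option_comp)
  then have "ind (?g ` h ` T) M (?g ` uni N)"
    using b(2) ind_aut_fix_iff[OF g(1) M small_subset_aut_image[OF h(1) T] NC] g(2) MA by auto
  then have "ind T M (uni (aut_model ?g N))" using ainv_image[OF h(1) TC] by simp
  moreover have "A \<subseteq> uni (aut_model ?g N)" using AN g(2) by force
  moreover have "|uni (aut_model ?g N)| =o |uni N|"
    using card_of_aut_image[OF g(1) small_modelD(3)[OF N]] by simp
  ultimately show ?thesis using that small_aut_model[OF g(1) N] by blast
qed

end

section \<open>The rank\<close>

lemma is_succ_unique: "is_succ \<beta> \<alpha> \<Longrightarrow> is_succ \<gamma> \<alpha> \<Longrightarrow> \<beta> = \<gamma>"
  unfolding is_succ_def by (metis leD linorder_neqE)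

lemma is_succ_not_zero: "is_succ \<beta> \<alpha> \<Longrightarrow> \<not> is_zero \<alpha>"
  unfolding is_succ_def is_zero_def by (meson leD)

lemma is_succ_less_iff: "is_succ \<beta> \<alpha> \<Longrightarrow> \<gamma> < \<alpha> \<longleftrightarrow> \<gamma> \<le> \<beta>"
  unfolding is_succ_def by (meson leD leI le_less_trans)

lemma exists_is_succ:
  fixes \<alpha> \<beta> :: "'o::wellorder"
  assumes "\<alpha> < \<beta>" obtains \<gamma> where "is_succ \<alpha> \<gamma>"
proof -
  have "is_succ \<alpha> (LEAST \<gamma>. \<alpha> < \<gamma>)"
    unfolding is_succ_def using LeastI[of "\<lambda>\<gamma>. \<alpha> < \<gamma>", OF assms] Least_le[of "\<lambda>\<gamma>. \<alpha> < \<gamma>"] by auto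
  then show ?thesis using that by blast
qed

lemma U_ge_succD:
  assumes "U_ge K C ind M p \<alpha>" "is_succ \<beta> \<alpha>"
  shows "\<exists>M' p'. small_model K C M' \<and> |uni M'| =o |uni M| \<and> forking_extension K C ind M p M' p' \<and>
    U_ge K C ind M' p' \<beta>"
  using assms(1)
proof cases
  case (succ \<gamma> M' p')
  then show ?thesis using is_succ_unique[OF assms(2)] by blast
qed (use assms(2) is_succ_not_zero in \<open>auto simp: is_limit_def\<close>)

lemma U_ge_limitD:
  assumes "U_ge K C ind M p \<alpha>" "is_limit \<alpha>" "\<beta> < \<alpha>"
  shows "U_ge K C ind M p \<beta>"
  using assms(1) by cases (use assms(2,3) in \<open>auto simp: is_limit_def\<close>)

text \<open>Outer induction on \<alpha>, with an inner one on \<beta> when \<alpha> is the successor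
  of \<gamma>. If \<beta> is the successor of \<delta>, then \<delta> \<le> \<gamma>, so the
  extension that witnesses rank \<alpha> also witnesses rank \<beta>.\<close>

lemma U_ge_antimono:
  assumes "U_ge K C ind M p \<alpha>" "\<beta> \<le> \<alpha>"
  shows "U_ge K C ind M p \<beta>"
  using assms
proof (induction \<alpha> arbitrary: M p \<beta> rule: less_induct)
  case (less \<alpha>)
  show ?case
  proof (cases \<alpha> rule: ordinal_cases)
    case zero
    then have "\<beta> = \<alpha>" using less.prems(2) by (simp add: is_zero_def antisym)
    then show ?thesis using less.prems(1) by simp
  next
    case limit
    then show ?thesis using U_ge_limitD less.prems by (metis le_less)
  next
    case (succ \<gamma>)
    obtain M' p' where p': "small_model K C M'" "|uni M'| =o |uni M|"
        "forking_extension K C ind M p M' p'" "U_ge K C ind M' p' \<gamma>"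
      using U_ge_succD[OF less.prems(1) succ] by blast
    show ?thesis
      using less.prems(2)
    proof (induction \<beta> rule: less_induct)
      case (less \<beta>)
      show ?case
      proof (cases \<beta> rule: ordinal_cases)
        case zero then show ?thesis by (rule U_ge.zero)
      next
        case limit
        show ?thesis
        proof (rule U_ge.limit[OF limit])
          fix \<delta> assume "\<delta> < \<beta>"
          then show "U_ge K C ind M p \<delta>" using less.IH[of \<delta>] less.prems by simp
        qed
      next
        case (succ \<delta>)
        then have "\<delta> < \<alpha>" using less.prems by (auto simp: is_succ_def)
        then have "\<delta> \<le> \<gamma>" using is_succ_less_iff \<open>is_succ \<gamma> \<alpha>\<close> by blast
        then have "U_ge K C ind M' p' \<delta>"
          using \<open>\<And>y M p \<beta>. y < \<alpha> \<Longrightarrow> U_ge K C ind M p y \<Longrightarrow> \<beta> \<le> y \<Longrightarrow> U_ge K C ind M p \<beta>\<close> p'(4)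
            \<open>is_succ \<gamma> \<alpha>\<close> unfolding is_succ_def by blast
        then show ?thesis by (rule U_ge.succ[OF succ p'(1-3)])
      qed
    qed
  qed
qed

context simple_monster
begin

section \<open>Ranks of 1-types in terms of realizations\<close>

abbreviation tp :: "'a \<Rightarrow> ('f, 'r, 'a) struc \<Rightarrow> ('o \<Rightarrow> 'a option) set" where
  "tp b M \<equiv> gtp K C (point b) (uni M)"

abbreviation rank_ge :: "'o \<Rightarrow> ('f, 'r, 'a) struc \<Rightarrow> 'a \<Rightarrow> bool" where
  "rank_ge \<alpha> M b \<equiv> U_ge K C ind M (tp b M) \<alpha>"

text \<open>A 1-type over a small model is coded by the universe and a realization; this bounds the
  number of codes.\<close>

lemma pair_card: "|UNIV :: ('a set \<times> 'a) set| <o |UNIV :: 'o set|"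
proof -
  have inf: "infinite (UNIV :: 'a set set)"
    using infinite_C finite_subset[OF subset_UNIV] by (metis Finite_Set.finite_set)
  have "|UNIV :: 'a set| \<le>o |UNIV :: 'a set set|"
    using card_of_Pow[of UNIV] ordLess_imp_ordLeq by fastforce
  then have "|(UNIV :: 'a set set) \<times> (UNIV :: 'a set)| \<le>o |UNIV :: 'a set set|"
    using inf by (intro card_of_Sigma_ordLeq_infinite) (auto simp: card_of_mono1)
  then show ?thesis using large by (simp add: ordLeq_ordLess_trans)
qed

lemma nat_less: "|UNIV :: nat set| <o |UNIV :: 'o set|"
proof -
  have "|UNIV :: nat set| <o |uni C|" by (rule ordLeq_ordLess_trans[OF nat_ordLeq_LS LS_less])
  moreover have "|uni C| \<le>o |UNIV :: 'a set|" by (simp add: card_of_mono1)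
  moreover have "|UNIV :: 'a set| <o |UNIV :: 'a set set|" using card_of_Pow[of UNIV] by simp
  ultimately show ?thesis
    using large by (meson ordLeq_ordLess_trans ordLess_ordLeq_trans ordLess_transitive)
qed

lemma infinite_ord: "infinite (UNIV :: 'o set)"
  unfolding infinite_iff_card_of_nat using nat_less by (rule ordLess_imp_ordLeq)

lemma gS1_iff: "p \<in> gS1 K C A \<longleftrightarrow> (\<exists>a\<in>uni C. p = gtp K C (point a :: 'o \<Rightarrow> 'a option) A)"
proof -
  have two: "\<exists>x y :: 'o. x \<noteq> y" using infinite_ord by (metis (full_types) UNIV_eq_I finite.simps insertI1)
  have "dom b = {..<ord_one :: 'o} \<and> ran b \<subseteq> uni C \<longleftrightarrow> (\<exists>a\<in>uni C. b = point a)" for b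
  proof
    assume b: "dom b = {..<ord_one :: 'o} \<and> ran b \<subseteq> uni C"
    then have "dom b = {LEAST x. True}" using lessThan_ord_one[OF two] by simp
    then obtain a where "b = point a" unfolding point_def using dom_eq_singleton_conv by metis
    then show "\<exists>a\<in>uni C. b = point a" using b by auto
  next
    assume "\<exists>a\<in>uni C. b = point a"
    then show "dom b = {..<ord_one :: 'o} \<and> ran b \<subseteq> uni C"
      unfolding lessThan_ord_one[OF two] by (elim bexE) simp
  qed
  then show ?thesis by (auto simp: gS_def)
qed

lemma nonforking_point_iff:
  assumes "small_model K C M" "small_model K C N" "uni M \<subseteq> uni N" "b \<in> uni C"
  shows "nonforking K C ind (tp b N) (uni N) M \<longleftrightarrow> ind {b} M (uni N)"
  using nonforking_iff[OF assms(1) small_modelD(2)[OF assms(2)] assms(3), of "point b"]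
    small_singleton[OF assms(4)] by simp

lemma tp_eq_iff:
  assumes "small_model K C M" "b \<in> uni C"
  shows "tp b M = tp c M \<longleftrightarrow> (\<exists>h. aut h \<and> (\<forall>a\<in>uni M. h a = a) \<and> c = h b)"
  using gtp_eq_iff[OF small_modelD(3)[OF assms(1)], of "point b" "point c"] assms(2)
  by (simp add: map_option_point)

lemma forking_extension_iff:
  assumes "small_model K C M" "small_model K C M'" "b \<in> uni C" "b' \<in> uni C"
  shows "forking_extension K C ind M (tp b M) M' (tp b' M') \<longleftrightarrow>
    uni M \<subseteq> uni M' \<and> tp b' M = tp b M \<and> \<not> ind {b'} M (uni M')"
proof (cases "uni M \<subseteq> uni M'")
  case True
  then show ?thesis
    using assms grestrict_gtp[OF True small_modelD(3)[OF assms(2)], of "point b'"]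
      nonforking_point_iff[OF assms(1,2) True assms(4)] leK_iff[OF assms(1,2)]
    by (auto simp: forking_extension_def gS1_iff)
next
  case False
  then show ?thesis using leK_uni by (auto simp: forking_extension_def)
qed

lemma rank_ge_succI:
  assumes "is_succ \<beta> \<alpha>" "small_model K C M" "small_model K C M'" "b \<in> uni C" "b' \<in> uni C"
    "|uni M'| =o |uni M|" "uni M \<subseteq> uni M'" "tp b' M = tp b M" "\<not> ind {b'} M (uni M')"
    "rank_ge \<beta> M' b'"
  shows "rank_ge \<alpha> M b"
  using U_ge.succ[OF assms(1,3,6) _ assms(10)] forking_extension_iff[OF assms(2-5)] assms by simp

lemma rank_ge_succD:
  assumes "rank_ge \<alpha> M b" "is_succ \<beta> \<alpha>" "small_model K C M" "b \<in> uni C"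
  obtains M' b' where "small_model K C M'" "b' \<in> uni C" "|uni M'| =o |uni M|" "uni M \<subseteq> uni M'"
    "tp b' M = tp b M" "\<not> ind {b'} M (uni M')" "rank_ge \<beta> M' b'"
proof -
  obtain M' p' where p': "small_model K C M'" "|uni M'| =o |uni M|"
      "forking_extension K C ind M (tp b M) M' p'" "U_ge K C ind M' p' \<beta>"
    using U_ge_succD[OF assms(1,2)] by blast
  then obtain b' where b': "b' \<in> uni C" "p' = tp b' M'"
    by (auto simp: forking_extension_def gS1_iff)
  show ?thesis
    using that[OF p'(1) b'(1) p'(2)] p'(3,4) forking_extension_iff[OF assms(3) p'(1) assms(4) b'(1)]
    unfolding b'(2) by blast
qed

lemma rank_ge_aut:
  assumes "rank_ge \<alpha> M b" "aut f" "small_model K C M" "b \<in> uni C"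
  shows "rank_ge \<alpha> (aut_model f M) (f b)"
  using assms
proof (induction \<alpha> arbitrary: M b rule: less_induct)
  case (less \<alpha>)
  show ?case
  proof (cases \<alpha> rule: ordinal_cases)
    case zero then show ?thesis by (rule U_ge.zero)
  next
    case limit
    show ?thesis
    proof (rule U_ge.limit[OF limit])
      fix \<beta> assume "\<beta> < \<alpha>"
      then show "rank_ge \<beta> (aut_model f M) (f b)"
        using less.IH[OF _ U_ge_limitD[OF less.prems(1) limit] less.prems(2-4)] by simp
    qed
  next
    case (succ \<beta>)
    from less.prems(1) succ less.prems(3,4)
    obtain M' b' where b': "small_model K C M'" "b' \<in> uni C" "|uni M'| =o |uni M|" "uni M \<subseteq> uni M'"
        "tp b' M = tp b M" "\<not> ind {b'} M (uni M')" "rank_ge \<beta> M' b'"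
      by (rule rank_ge_succD)
    obtain h where h: "aut h" "\<forall>a\<in>uni M. h a = a" "b = h b'"
      using b'(5) tp_eq_iff[OF less.prems(3) b'(2)] by blast
    \<comment> \<open>\<open>h\<close> moves \<open>b'\<close> to \<open>b\<close> over
      \<open>M\<close>; its conjugate by \<open>f\<close> does the same for the images.\<close>
    let ?h = "f \<circ> h \<circ> ainv f"
    have fix_fM: "\<forall>a\<in>uni (aut_model f M). ?h a = a"
      using h(2) ainv_left[OF less.prems(2)] small_modelD(3)[OF less.prems(3)] by auto
    have "aut ?h" using less.prems(2) h(1) aut_comp aut_ainv by blast
    moreover have "f b = ?h (f b')" using ainv_left[OF less.prems(2) b'(2)] h(3) by simp
    ultimately have "tp (f b') (aut_model f M) = tp (f b) (aut_model f M)"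
      using tp_eq_iff[OF small_aut_model[OF less.prems(2,3)] aut_in[OF less.prems(2) b'(2)]] fix_fM
      by blast
    moreover have "|uni (aut_model f M')| =o |uni (aut_model f M)|"
      using card_of_aut_image[OF less.prems(2) small_modelD(3)] less.prems(3) b'(1,3)
      unfolding uni_aut_model by (meson ordIso_symmetric ordIso_transitive)
    moreover have "\<not> ind {f b'} (aut_model f M) (uni (aut_model f M'))"
      using ind_aut_iff[OF less.prems(2,3) small_singleton[OF b'(2)] small_modelD(2)[OF b'(1)]] b'(6)
      by simp
    moreover have "rank_ge \<beta> (aut_model f M') (f b')"
      using less.IH[OF _ b'(7) less.prems(2) b'(1,2)] succ by (simp add: is_succ_def)
    moreover have "uni (aut_model f M) \<subseteq> uni (aut_model f M')" using b'(4) by auto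
    ultimately show ?thesis
      by (intro rank_ge_succI[OF succ, of "aut_model f M" "aut_model f M'" "f b" "f b'"])
        (use less.prems b' small_aut_model aut_in in auto)
  qed
qed

text \<open>The realization \<open>b'\<close> of the forking extension has the same type over
  \<open>M\<close> as \<open>b\<close>. An automorphism over \<open>M\<close> from \<open>b'\<close>
  to \<open>b\<close> moves the larger model instead of changing the element.\<close>

lemma rank_ge_succ_same:
  assumes "rank_ge \<alpha> M b" "is_succ \<beta> \<alpha>" "small_model K C M" "b \<in> uni C"
  obtains M' where "small_model K C M'" "|uni M'| =o |uni M|" "uni M \<subseteq> uni M'"
    "\<not> ind {b} M (uni M')" "rank_ge \<beta> M' b"
proof -
  from assms
  obtain M' b' where b': "small_model K C M'" "b' \<in> uni C" "|uni M'| =o |uni M|" "uni M \<subseteq> uni M'"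
      "tp b' M = tp b M" "\<not> ind {b'} M (uni M')" "rank_ge \<beta> M' b'"
    by (rule rank_ge_succD)
  obtain h where h: "aut h" "\<forall>a\<in>uni M. h a = a" "b = h b'"
    using b'(5) tp_eq_iff[OF assms(3) b'(2)] by blast
  have "uni M \<subseteq> uni (aut_model h M')" using b'(4) h(2) by force
  moreover have "\<not> ind {b} M (uni (aut_model h M'))"
    using ind_aut_fix_iff[OF h(1) assms(3) small_singleton[OF b'(2)] small_modelD(2)[OF b'(1)] h(2)]
      b'(6) h(3) by simp
  moreover have "|uni (aut_model h M')| =o |uni M|"
    using card_of_aut_image[OF h(1) small_modelD(3)[OF b'(1)]] b'(3)
    unfolding uni_aut_model by (meson ordIso_transitive)
  moreover have "rank_ge \<beta> (aut_model h M') b"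
    using rank_ge_aut[OF b'(7) h(1) b'(1,2)] h(3) by simp
  ultimately show ?thesis using that small_aut_model[OF h(1) b'(1)] by blast
qed

text \<open>A wellordered type of large cardinality may have small cofinality, so bounding the ranks from
  above by a supremum is not possible; instead two consecutive ranks are identified by counting.\<close>

lemma rank_stabilizes:
  "\<exists>\<alpha> \<alpha>' :: 'o. is_succ \<alpha> \<alpha>' \<and>
    (\<forall>M b. small_model K C M \<and> b \<in> uni C \<and> rank_ge \<alpha> M b \<longrightarrow> rank_ge \<alpha>' M b)"
proof (rule ccontr)
  assume no: "\<not> ?thesis"
  \<comment> \<open>\<open>'o\<close> may have a greatest element; \<open>?D\<close> consists of all
    the other ordinals.\<close>
  let ?D = "{\<alpha> :: 'o. \<exists>\<alpha>'. is_succ \<alpha> \<alpha>'}"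
  have "\<exists>M b. small_model K C M \<and> b \<in> uni C \<and> rank_ge \<alpha> M b \<and>
      (\<forall>\<alpha>'. is_succ \<alpha> \<alpha>' \<longrightarrow> \<not> rank_ge \<alpha>' M b)" if \<alpha>: "\<alpha> \<in> ?D" for \<alpha>
  proof -
    obtain \<alpha>' where succ: "is_succ \<alpha> \<alpha>'" using \<alpha> by blast
    moreover have "\<alpha>'' = \<alpha>'" if "is_succ \<alpha> \<alpha>''" for \<alpha>''
      using that succ unfolding is_succ_def by (meson antisym)
    ultimately show ?thesis using no by metis
  qed
  then obtain F x where F: "\<And>\<alpha>. \<alpha> \<in> ?D \<Longrightarrow> small_model K C (F \<alpha>) \<and> x \<alpha> \<in> uni C \<and>
      rank_ge \<alpha> (F \<alpha>) (x \<alpha>) \<and> (\<forall>\<alpha>'. is_succ \<alpha> \<alpha>' \<longrightarrow> \<not> rank_ge \<alpha>' (F \<alpha>) (x \<alpha>))"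
    by metis
  \<comment> \<open>The pair chosen for \<alpha> has rank at least \<alpha> but not at least its
    successor, so by antimonotonicity no later ordinal can share it.\<close>
  have ne: "(uni (F \<alpha>), x \<alpha>) \<noteq> (uni (F \<beta>), x \<beta>)" if ab: "\<alpha> \<in> ?D" "\<beta> \<in> ?D" "\<alpha> < \<beta>" for \<alpha> \<beta>
  proof
    assume eq: "(uni (F \<alpha>), x \<alpha>) = (uni (F \<beta>), x \<beta>)"
    then have "F \<alpha> = F \<beta>" using F[OF ab(1)] F[OF ab(2)] small_model_eqI by blast
    moreover obtain \<alpha>' where \<alpha>': "is_succ \<alpha> \<alpha>'" using ab(1) by blast
    then have "\<alpha>' \<le> \<beta>" using ab(3) by (auto simp: is_succ_def)
    ultimately show False
      using F[OF ab(1)] F[OF ab(2)] U_ge_antimono[of K C ind "F \<beta>" "tp (x \<beta>) (F \<beta>)" \<beta> \<alpha>'] \<alpha>' eq by auto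
  qed
  have "inj_on (\<lambda>\<alpha>. (uni (F \<alpha>), x \<alpha>)) ?D"
    by (rule inj_onI) (metis (no_types, lifting) ne linorder_neqE)
  then have "|?D| \<le>o |UNIV :: ('a set \<times> 'a) set|" using card_of_ordLeq by (metis subset_UNIV)
  then have D_less: "|?D| <o |UNIV :: 'o set|" using pair_card ordLeq_ordLess_trans by blast
  \<comment> \<open>At most one ordinal lies outside \<open>?D\<close>, so \<open>?D\<close> being
    smaller than \<open>'o\<close> is absurd.\<close>
  have "\<alpha> = \<beta>" if "\<alpha> \<notin> ?D" "\<beta> \<notin> ?D" for \<alpha> \<beta>
    using that exists_is_succ by (metis (mono_tags, lifting) linorder_neqE mem_Collect_eq)
  then have "\<exists>a. UNIV - ?D \<subseteq> {a}" by blast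
  then have "finite (UNIV - ?D)" using finite_subset by blast
  then have "|UNIV - ?D| <o |UNIV :: 'o set|"
    using infinite_ord finite_ordLess_infinite[of "|UNIV - ?D|" "|UNIV :: 'o set|"]
    by (simp add: Field_card_of card_of_well_order_on)
  from card_of_Un_ordLess_infinite[OF infinite_ord D_less this] show False
    using ordLess_irreflexive[of "|UNIV :: 'o set|"] by (simp add: Un_Diff_cancel)
qed

text \<open>Rank at least \<alpha> gives rank at least \<alpha>', hence a forking extension again of
  rank at least \<alpha>, to which the induction hypothesis applies.\<close>

lemma rank_ge_stable:
  assumes succ: "is_succ \<alpha> \<alpha>'"
    and stable: "\<And>M b. small_model K C M \<Longrightarrow> b \<in> uni C \<Longrightarrow> rank_ge \<alpha> M b \<Longrightarrow> rank_ge \<alpha>' M b"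
    and M: "small_model K C M" and b: "b \<in> uni C" and "rank_ge \<alpha> M b"
  shows "rank_ge \<gamma> M b"
  using M b \<open>rank_ge \<alpha> M b\<close>
proof (induction \<gamma> arbitrary: M b rule: less_induct)
  case (less \<gamma>)
  show ?case
  proof (cases \<gamma> rule: ordinal_cases)
    case zero then show ?thesis by (rule U_ge.zero)
  next
    case limit
    show ?thesis by (rule U_ge.limit[OF limit]) (rule less.IH[OF _ less.prems])
  next
    case (succ \<delta>)
    obtain M' where M': "small_model K C M'" "|uni M'| =o |uni M|" "uni M \<subseteq> uni M'"
        "\<not> ind {b} M (uni M')" "rank_ge \<alpha> M' b"
      using rank_ge_succ_same[OF stable[OF less.prems] assms(1) less.prems(1,2)] by metis
    have "rank_ge \<delta> M' b"
      using less.IH[OF _ M'(1) less.prems(2) M'(5)] succ by (simp add: is_succ_def)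
    then show ?thesis
      using rank_ge_succI[OF succ less.prems(1) M'(1) less.prems(2,2)] M' by blast
  qed
qed

text \<open>The stable \<alpha> does not depend on the type: an extension witnessing rank \<alpha>'
  has rank at least \<alpha>, and therefore every rank.\<close>

lemma infinite_rank_step:
  assumes "\<And>\<gamma>. rank_ge \<gamma> M b" "small_model K C M" "b \<in> uni C"
  obtains M' where "small_model K C M'" "|uni M'| =o |uni M|" "uni M \<subseteq> uni M'"
    "\<not> ind {b} M (uni M')" "\<And>\<gamma>. rank_ge \<gamma> M' b"
proof -
  obtain \<alpha> \<alpha>' :: 'o where \<alpha>: "is_succ \<alpha> \<alpha>'"
    "\<And>M b. small_model K C M \<Longrightarrow> b \<in> uni C \<Longrightarrow> rank_ge \<alpha> M b \<Longrightarrow> rank_ge \<alpha>' M b"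
    using rank_stabilizes by blast
  obtain M' where M': "small_model K C M'" "|uni M'| =o |uni M|" "uni M \<subseteq> uni M'"
      "\<not> ind {b} M (uni M')" "rank_ge \<alpha> M' b"
    using rank_ge_succ_same[OF assms(1) \<alpha>(1) assms(2,3)] by metis
  then show ?thesis using that rank_ge_stable[OF \<alpha> M'(1) assms(3) M'(5)] by blast
qed

end

section \<open>Supersimplicity and ranks\<close>

context simple_monster
begin

lemma finite_rank_if_finite_local_character:
  assumes flc: "ind_finite_local_character ord K C ind"
    and M: "small_model K C M" and b: "b \<in> uni C"
  shows "\<not> U_infinite K C ind M (tp b M)"
proof
  assume "U_infinite K C ind M (tp b M)"
  then have inf: "\<forall>\<gamma>. rank_ge \<gamma> M b" by (simp add: U_infinite_def)
  let ?P = "\<lambda>N. small_model K C N \<and> |uni N| =o |uni M| \<and> (\<forall>\<gamma>. rank_ge \<gamma> N b)"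
  \<comment> \<open>\<open>?P\<close> keeps the size, which makes the union of the chain small, and
    the infinite rank, which allows the next step.\<close>
  have "\<exists>N. \<forall>n. ?P (N n) \<and> (uni (N n) \<subseteq> uni (N (Suc n)) \<and> \<not> ind {b} (N n) (uni (N (Suc n))))"
  proof (rule dependent_nat_choice)
    show "\<exists>N. ?P N" using M inf card_of_refl by blast
  next
    fix N :: "('f, 'r, 'a) struc" and n :: nat assume N: "?P N"
    then obtain N' where "small_model K C N'" "|uni N'| =o |uni N|" "uni N \<subseteq> uni N'"
        "\<not> ind {b} N (uni N')" "\<And>\<gamma>. rank_ge \<gamma> N' b"
      using infinite_rank_step[of N b] b by metis
    then show "\<exists>N'. ?P N' \<and> (uni N \<subseteq> uni N' \<and> \<not> ind {b} N (uni N'))"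
      using N ordIso_transitive by blast
  qed
  then obtain N where N: "\<And>n. small_model K C (N n)" "\<And>n. |uni (N n)| =o |uni M|"
      "\<And>n. uni (N n) \<subseteq> uni (N (Suc n))" "\<And>n. \<not> ind {b} (N n) (uni (N (Suc n)))"
    by blast
  have card: "|uni (N n)| =o |uni (N 0)|" for n
    using N(2) by (meson ordIso_symmetric ordIso_transitive)
  have step: "leK K (N n) (N (Suc n))" for n using leK_iff[OF N(1,1)] N(3) by simp
  obtain U where U: "small_model K C U" "uni U = (\<Union>n. uni (N n))"
    using union_of_chain[OF N(1) step card] by metis
  obtain \<omega> :: 'o and e :: "nat \<Rightarrow> 'o" where e: "strict_mono e" "range e = {..<\<omega>}"
    using exists_omega[OF nat_less] by metis
  \<comment> \<open>Chains are functions on all of \<open>'o\<close>; from \<omega> on the value is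
    constantly the union.\<close>
  define F where "F i = (if i < \<omega> then N (inv e i) else U)" for i
  have inj: "inj e" using e(1) by (rule strict_mono_imp_inj_on)
  have lt: "e n < \<omega>" for n using e(2) by auto
  have F_e: "F (e n) = N n" for n using lt inj by (simp add: F_def)
  have F_top: "F i = U" if "\<not> i < \<omega>" for i using that by (simp add: F_def)
  have ex_e: "\<exists>n. i = e n" if "i < \<omega>" for i using that e(2) by (metis lessThan_iff rangeE)
  have small_F: "small_model K C (F i)" for i using N(1) U(1) by (simp add: F_def)
  have N_mono: "uni (N m) \<subseteq> uni (N n)" if "m \<le> n" for m n
    using that N(3) by (rule lift_Suc_mono_le[of "\<lambda>n. uni (N n)", rotated])
  have "uni (F i) \<subseteq> uni (F j)" if "i \<le> j" for i j
  proof (cases "j < \<omega>")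
    case True
    then obtain m n where "i = e m" "j = e n" using ex_e \<open>i \<le> j\<close> le_less_trans by metis
    then show ?thesis using F_e N_mono \<open>i \<le> j\<close> strict_mono_less_eq[OF e(1)] by simp
  next
    case False
    then show ?thesis using F_top U(2) by (auto simp: F_def)
  qed
  then have mono: "leK K (F i) (F j)" if "i \<le> j" for i j
    using leK_iff[OF small_F small_F] that by simp
  have "uni (F j) = (\<Union>i\<in>{..<j}. uni (F i))" if "j \<le> \<omega>" "is_limit j" for j
  proof -
    have "j = \<omega>"
      using that ex_e not_is_limit_below_omega[OF e] by (metis le_less)
    moreover have "(\<Union>i\<in>{..<\<omega>}. uni (F i)) = (\<Union>n. uni (N n))"
      unfolding e(2)[symmetric] by (simp add: F_e)
    ultimately show ?thesis using F_top[of \<omega>] U(2) by simp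
  qed
  then have "continuous_chain K C \<omega> F"
    unfolding continuous_chain_def using small_F mono by blast
  moreover have "tp b U \<in> gS1 K C (uni (F \<omega>))" using F_top[of \<omega>] gS1_iff b by auto
  ultimately obtain i where i: "i < \<omega>" "nonforking K C ind (tp b U) (uni (F \<omega>)) (F i)"
    using flc is_limit_omega[OF e] unfolding ind_finite_local_character_def by blast
  then obtain n where n: "F i = N n" using ex_e F_e by metis
  have "ind {b} (N n) (uni U)"
    using i(2) n F_top[of \<omega>] nonforking_point_iff[OF N(1) U(1) _ b, of n] U(2) by auto
  then have "ind {b} (N n) (uni (N (Suc n)))"
    by (rule ind_mono) (use N(1) U small_modelD(2)[OF U(1)] small_singleton[OF b] in auto)
  then show False using N(4) by blast
qed

lemma finite_local_character_if_finite_ranks: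
  assumes witness: "finite_witness_property_singletons K C ind"
    and ranks: "\<And>M b. small_model K C M \<Longrightarrow> b \<in> uni C \<Longrightarrow> \<not> U_infinite K C ind M (tp b M)"
  shows "ind_finite_local_character ord K C ind"
  unfolding ind_finite_local_character_def
proof (intro allI impI, elim conjE, rule ccontr)
  fix \<delta> :: 'o and M :: "'o \<Rightarrow> ('f, 'r, 'a) struc" and p :: "('o \<Rightarrow> 'a option) set"
  assume lim: "is_limit \<delta>" and chain: "continuous_chain K C \<delta> M"
    and p: "p \<in> gS1 K C (uni (M \<delta>))"
    and forks: "\<not> (\<exists>i<\<delta>. nonforking K C ind p (uni (M \<delta>)) (M i))"
  obtain b where b: "b \<in> uni C" "p = tp b (M \<delta>)" using p gS1_iff by blast
  have small_M: "small_model K C (M i)" if "i \<le> \<delta>" for i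
    using chain that by (simp add: continuous_chain_def)
  have mono_M: "uni (M i) \<subseteq> uni (M j)" if "i \<le> j" "j \<le> \<delta>" for i j
    using chain that leK_uni unfolding continuous_chain_def by blast
  have M_sub: "uni (M i) \<subseteq> uni (M \<delta>)" if "i < \<delta>" for i
    by (rule mono_M[OF less_imp_le[OF that] order_refl])
  have M_\<delta>: "uni (M \<delta>) = (\<Union>i\<in>{..<\<delta>}. uni (M i))"
    using chain lim by (simp add: continuous_chain_def)
  have small_M\<delta>: "small_subset C (uni (M \<delta>))" using small_modelD(2)[OF small_M] by blast
  obtain i0 where i0: "i0 < \<delta>" using lim unfolding is_limit_def is_zero_def by (meson not_le)
  \<comment> \<open>The witness property reduces forking over \<open>M i\<close> to a finite set,
    which already lies in some model before the limit.\<close>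
  have dep: "\<exists>j. i \<le> j \<and> j < \<delta> \<and> \<not> ind {b} (M i) (uni (M j))" if i: "i < \<delta>" for i
  proof -
    have "\<not> ind {b} (M i) (uni (M \<delta>))"
      using forks i b nonforking_point_iff[OF small_M small_M mono_M, of i \<delta> b] by auto
    moreover have "leK K (M i) (M \<delta>)" using leK_iff small_M mono_M i by simp
    ultimately obtain A where A: "finite A" "A \<subseteq> uni (M \<delta>)" "\<not> ind {b} (M i) A"
      using witness i small_M b(1) unfolding finite_witness_property_singletons_def
      by (meson less_imp_le order_refl)
    have "\<exists>j. i \<le> j \<and> j < \<delta> \<and> A \<subseteq> uni (M j)"
      using A(1,2)
    proof (induction A)
      case empty then show ?case using i by blast
    next
      case (insert a A)
      then obtain j k where j: "i \<le> j" "j < \<delta>" "A \<subseteq> uni (M j)" and k: "k < \<delta>" "a \<in> uni (M k)"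
        using M_\<delta> by auto
      then have max: "i \<le> max j k" "max j k < \<delta>" by (auto simp: le_max_iff_disj)
      moreover have "uni (M j) \<subseteq> uni (M (max j k))" "uni (M k) \<subseteq> uni (M (max j k))"
        using mono_M less_imp_le[OF max(2)] by simp_all
      then have "insert a A \<subseteq> uni (M (max j k))" using j(3) k(2) by blast
      ultimately show ?case by blast
    qed
    then obtain j where j: "i \<le> j" "j < \<delta>" "A \<subseteq> uni (M j)" by blast
    have "\<not> ind {b} (M i) (uni (M j))"
      using ind_mono[of "{b}" "M i" "uni (M j)" "{b}" A] A(3) j i small_M small_modelD(2)
        small_singleton[OF b(1)] by auto
    with j show ?thesis by blast
  qed
  \<comment> \<open>All of \<open>uni (M \<delta>)\<close> is included, and not only
    \<open>b\<close>, so that base monotonicity can later replace the base \<open>M i\<close> by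
    \<open>M j\<close> inside \<open>T\<close>.\<close>
  define T where "T = insert b (uni (M \<delta>))"
  have T: "small_subset C T"
    using small_subset_Un[OF small_singleton[OF b(1)] small_M\<delta>] by (simp add: T_def)
  have bT: "{b} \<subseteq> T" by (simp add: T_def)
  have MT: "uni (M i) \<subseteq> T" if "i < \<delta>" for i using M_sub[OF that] by (auto simp: T_def)
  \<comment> \<open>\<open>|S|\<close> is the common size of the models below: the rank only admits
    extensions of equal size, while the \<open>M i\<close> may grow.\<close>
  obtain S where S: "uni (M \<delta>) \<subseteq> S" "small_subset C S" "infinite S" "LS K \<le>o |S|"
    using large_small_superset[OF small_M\<delta>] by metis
  define G where "G i N \<longleftrightarrow> i < \<delta> \<and> small_model K C N \<and> uni (M i) \<subseteq> uni N \<and> |uni N| =o |S| \<and>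
      ind T (M i) (uni N)" for i N
  have "\<exists>N. G i0 N"
  proof -
    obtain N0 where N0: "small_model K C N0" "S \<subseteq> uni N0" "|uni N0| =o |S|"
      using exists_model_of_card[OF S(2-4)] by metis
    have M0: "small_model K C (M i0)" using small_M i0 by simp
    have "uni (M i0) \<subseteq> uni N0" using M_sub[OF i0] S(1) N0(2) by blast
    from extend_independent[OF M0 T small_modelD(2)[OF M0] subset_refl ind_base[OF T M0] N0(1) this]
    obtain N where "small_model K C N" "uni (M i0) \<subseteq> uni N" "|uni N| =o |uni N0|"
        "ind T (M i0) (uni N)" by metis
    then show ?thesis unfolding G_def using i0 N0(3) ordIso_transitive by blast
  qed
  then obtain N0 where N0: "G i0 N0" by blast
  have step: "\<exists>j N'. G j N' \<and> uni N \<subseteq> uni N' \<and> \<not> ind {b} N (uni N')" if "G i N" for i N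
  proof -
    have i: "i < \<delta>" and N: "small_model K C N" and MN: "uni (M i) \<subseteq> uni N"
      and card: "|uni N| =o |S|" and ind: "ind T (M i) (uni N)"
      using that by (auto simp: G_def)
    obtain j where j: "i \<le> j" "j < \<delta>" "\<not> ind {b} (M i) (uni (M j))" using dep[OF i] by blast
    have Mi: "small_model K C (M i)" and Mj: "small_model K C (M j)" using small_M i j by auto
    note NC = small_modelD(2)[OF N] and MjC = small_modelD(2)[OF Mj]
    let ?A = "uni N \<union> uni (M j)"
    have A: "small_subset C ?A" by (rule small_subset_Un[OF NC MjC])
    have "ind (uni N) (M i) T" by (rule ind_sym[OF ind Mi T NC])
    then have "ind (uni N) (M j) T"
      by (rule ind_base_mono) (use Mi Mj T NC MT j mono_M[of i j] in auto)
    then have "ind T (M j) (uni N)" by (rule ind_sym[OF _ Mj NC T])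
    then have indA: "ind T (M j) ?A" by (rule ind_normal[OF _ Mj T NC])
    have "|uni (M j)| \<le>o |S|" using M_sub[OF j(2)] S(1) by (intro card_of_mono1) blast
    then have "|?A| \<le>o |S|"
      using S(3) card
      by (intro card_of_Un_ordLeq_infinite_Field)
        (auto simp: ordIso_iff_ordLeq Field_card_of card_of_card_order_on)
    moreover have "|uni N| \<le>o |?A|" by (simp add: card_of_mono1)
    then have SA: "|S| \<le>o |?A|" using card by (meson ordIso_ordLeq_trans ordIso_symmetric)
    ultimately have cardA: "|?A| =o |S|" by (simp add: ordIso_iff_ordLeq)
    obtain N1 where N1: "small_model K C N1" "?A \<subseteq> uni N1" "|uni N1| =o |?A|"
      using exists_model_of_card[OF A card_of_ordLeq_infinite[OF SA S(3)] ordLeq_transitive[OF S(4) SA]]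
      by metis
    obtain N' where N': "small_model K C N'" "?A \<subseteq> uni N'" "|uni N'| =o |uni N1|"
        "ind T (M j) (uni N')"
      using extend_independent[OF Mj T A _ indA N1(1,2)] by auto
    have "|uni N'| =o |S|" using N'(3) N1(3) cardA ordIso_transitive by blast
    then have "G j N'" using N' j(2) by (simp add: G_def)
    \<comment> \<open>Otherwise transitivity through \<open>N\<close> would make \<open>b\<close>
      independent from \<open>N'\<close>, and so from \<open>M j\<close>, over
      \<open>M i\<close>.\<close>
    moreover have "\<not> ind {b} N (uni N')"
    proof
      assume NN': "ind {b} N (uni N')"
      note bC = small_singleton[OF b(1)] and N'C = small_modelD(2)[OF N'(1)]
      have "ind {b} (M i) (uni N)" by (rule ind_mono[OF ind Mi T NC bT subset_refl])
      then have "ind {b} (M i) (uni N')" by (rule ind_trans[OF _ NN' Mi N bC N'C MN])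
      then have "ind {b} (M i) (uni (M j))" using ind_mono[OF _ Mi bC N'C subset_refl] N'(2) by simp
      then show False using j(3) by blast
    qed
    ultimately show ?thesis using N'(2) by blast
  qed
  \<comment> \<open>The index \<open>i\<close> and the model \<open>N\<close> vary in the induction,
    since each forking step leads to a later index.\<close>
  have "rank_ge \<alpha> N b" if "G i N" for \<alpha> i N
    using that
  proof (induction \<alpha> arbitrary: i N rule: less_induct)
    case (less \<alpha>)
    show ?case
    proof (cases \<alpha> rule: ordinal_cases)
      case zero then show ?thesis by (rule U_ge.zero)
    next
      case limit
      show ?thesis by (rule U_ge.limit[OF limit]) (rule less.IH[OF _ less.prems])
    next
      case (succ \<beta>)
      obtain j N' where N': "G j N'" "uni N \<subseteq> uni N'" "\<not> ind {b} N (uni N')"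
        using step[OF less.prems] by blast
      have "small_model K C N" "small_model K C N'" "|uni N'| =o |uni N|"
        using less.prems N'(1) unfolding G_def by (auto intro: ordIso_transitive ordIso_symmetric)
      moreover have "rank_ge \<beta> N' b" using less.IH[OF _ N'(1)] succ by (simp add: is_succ_def)
      ultimately show ?thesis using rank_ge_succI[OF succ _ _ b(1) b(1)] N'(2,3) by blast
    qed
  qed
  then have "U_infinite K C ind N0 (tp b N0)" using N0 by (simp add: U_infinite_def)
  then show False using ranks N0 b(1) by (simp add: G_def)
qed

end

theorem theorem7p12:
  fixes K :: "('f, 'r, 'a) aclass"
    and C :: "('f, 'r, 'a) struc"
    and ind :: "('f, 'r, 'a) indep"
  assumes "|UNIV :: 'a set set| <o |UNIV :: 'o::wellorder set|"
    and "is_aec K" and "joint_embedding K" and "amalgamation K" and "no_maximal_models K"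
    and "monster_model K C"
    and "simple_independence_relation TYPE('o) K C ind"
    and "finite_witness_property_singletons K C ind"
  shows "supersimple_independence_relation TYPE('o) K C ind \<longleftrightarrow>
    (\<forall>M. \<forall>p :: ('o \<Rightarrow> 'a option) set.
       small_model K C M \<and> p \<in> gS1 K C (uni M) \<longrightarrow> \<not> U_infinite K C ind M p)"
proof -
  interpret simple_monster K C "TYPE('o)" ind
    by unfold_locales (fact assms)+
  have types: "(\<forall>M. \<forall>p :: ('o \<Rightarrow> 'a option) set.
      small_model K C M \<and> p \<in> gS1 K C (uni M) \<longrightarrow> \<not> U_infinite K C ind M p) \<longleftrightarrow>
    (\<forall>M b. small_model K C M \<longrightarrow> b \<in> uni C \<longrightarrow> \<not> U_infinite K C ind M (tp b M))"
    unfolding gS1_iff by auto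
  show ?thesis
    unfolding types supersimple_independence_relation_def
    using assms(7) finite_rank_if_finite_local_character
      finite_local_character_if_finite_ranks[OF assms(8)]
    by auto
qed

end
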